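(* Fix a $p\in(2,\infty)$ and $0<a<1$. Then for every $|\rho|\le 1$ and $\theta\in\mathbb{R}$, there exists an $\omega$ such that the density $$f_X(x)\propto e^{-\frac{1-a}{a}\frac{x^2}{2}}\left(1+\rho\cos\left(\frac{\omega x}{\sqrt{a}}+\theta\right)\right),\qquad x\in\mathbb{R},$$ induces a linear minimum $L^p$ estimator. Moreover, for even $p$, the $\omega$'s are given by the zeros of the probabilist's Hermite polynomial $H_{e_{p-1}}$.
   Context: This is the scalar case $n=1$: $X$ is a real random variable with probability density $f_X$, $Y=X+Z$ with $Z\sim\mathcal{N}(0,1)$ independent of $X$, and $\rho,\theta,\omega$ are real. The minimum $L^p$ estimator of $X$ from $Y$ is the measurable function $f:\mathbb{R}\to\mathbb{R}$ (unique for $p>1$, up to almost sure equality) attaining $\inf_{f\text{ measurable}}\mathbb{E}\left[|X-f(Y)|^p\right]$. The density $f_X$ induces a linear minimum $L^p$ estimator if, for $X$ with density $f_X$, this estimator has the form $f(y)=cy$ for some constant $c\ge0$ (equality in the almost sure sense). The symbol $\propto$ means equality up to a positive normalizing constant. The probabilist's Hermite polynomials are $H_{e_m}(x)=(-1)^m e^{x^2/2}\frac{\mathrm{d}^m}{\mathrm{d}x^m}e^{-x^2/2}$.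
   Formalization: For even p, that every working ω is a zero of the Hermite polynomial is stated only for ρ≠0 (for ρ=0 the density is Gaussian and every ω works); the case ω=0 with ρcosθ=−1, where no density exists, is excluded. *)

theory Defs
  imports "HOL-Probability.Probability"
begin

definition prob_density :: "(real \<Rightarrow> real) \<Rightarrow> bool" where
  "prob_density f \<longleftrightarrow> f \<in> borel_measurable borel \<and> (\<forall>x. 0 \<le> f x) \<and> prob_space (density lborel (\<lambda>x. ennreal (f x)))"

(* The cost takes values in [0,\<infinity>], so that an infinite p-th moment is not mistaken for 0. *)
definition Lp_cost ::
  "real \<Rightarrow> 'w measure \<Rightarrow> ('w \<Rightarrow> real) \<Rightarrow> ('w \<Rightarrow> real) \<Rightarrow> (real \<Rightarrow> real) \<Rightarrow> ennreal" where
  "Lp_cost p M X Y f = (\<integral>\<^sup>+ w. ennreal (\<bar>X w - f (Y w)\<bar> powr p) \<partial>M)"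

definition min_Lp_estimator ::
  "real \<Rightarrow> 'w measure \<Rightarrow> ('w \<Rightarrow> real) \<Rightarrow> ('w \<Rightarrow> real) \<Rightarrow> (real \<Rightarrow> real) \<Rightarrow> bool" where
  "min_Lp_estimator p M X Y f \<longleftrightarrow>
     f \<in> borel_measurable borel \<and>
     Lp_cost p M X Y f = (INF g \<in> borel_measurable borel. Lp_cost p M X Y g)"

definition gaussian_noise_model ::
  "(real \<Rightarrow> real) \<Rightarrow> 'w measure \<Rightarrow> ('w \<Rightarrow> real) \<Rightarrow> ('w \<Rightarrow> real) \<Rightarrow> bool" where
  "gaussian_noise_model f M X Z \<longleftrightarrow>
     prob_space M \<and>
     distributed M lborel X (\<lambda>x. ennreal (f x)) \<and>
     distributed M lborel Z (\<lambda>z. ennreal (std_normal_density z)) \<and>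
     prob_space.indep_var M borel X borel Z"

(* The notions involved depend only on the joint law of (X, Z), a measure on the plane, so letting
   the sample space range over measures on real \<times> real loses no generality. The canonical model
   below shows that the quantification over models is not vacuous. Since "the" estimator is only
   determined up to almost sure equality, all minimizers are required to agree a.s. with c * y. *)
definition induces_linear_min_Lp_estimator :: "real \<Rightarrow> (real \<Rightarrow> real) \<Rightarrow> bool" where
  "induces_linear_min_Lp_estimator p f \<longleftrightarrow>
     prob_density f \<and>
     (\<exists>c\<ge>0. \<forall>(M :: (real \<times> real) measure) X Z. gaussian_noise_model f M X Z \<longrightarrow>
        min_Lp_estimator p M X (\<lambda>w. X w + Z w) (\<lambda>y. c * y) \<and>
        (\<forall>g. min_Lp_estimator p M X (\<lambda>w. X w + Z w) g \<longrightarrow>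
             (AE w in M. g (X w + Z w) = c * (X w + Z w))))"

lemma gaussian_noise_model_canonical:
  assumes "prob_density f"
  shows "gaussian_noise_model f
    (density lborel (\<lambda>x. ennreal (f x)) \<Otimes>\<^sub>M density lborel (\<lambda>z. ennreal (std_normal_density z))) fst snd"
proof -
  let ?A = "density lborel (\<lambda>x. ennreal (f x))"
  let ?B = "density lborel (\<lambda>z. ennreal (std_normal_density z))"
  have f: "f \<in> borel_measurable borel" and A: "prob_space ?A"
    using assms by (auto simp: prob_density_def)
  have B: "prob_space ?B" by (rule prob_space_normal_density) simp
  interpret A: prob_space ?A by (rule A)
  interpret B: prob_space ?B by (rule B)
  interpret AB: pair_prob_space ?A ?B ..
  have 1: "distr (?A \<Otimes>\<^sub>M ?B) borel fst = ?A"
  proof -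
    have "distr (?A \<Otimes>\<^sub>M ?B) borel fst = distr (?A \<Otimes>\<^sub>M ?B) ?A fst"
      by (rule distr_cong) auto
    then show ?thesis using B.distr_pair_fst[of ?A] by simp
  qed
  have 2: "distr (?A \<Otimes>\<^sub>M ?B) borel snd = ?B"
  proof -
    have "distr (?A \<Otimes>\<^sub>M ?B) borel snd = distr (?A \<Otimes>\<^sub>M ?B) ?B snd"
      by (rule distr_cong) auto
    also have "\<dots> = ?B"
    proof (rule measure_eqI)
      fix S assume "S \<in> sets (distr (?A \<Otimes>\<^sub>M ?B) ?B snd)"
      then have S: "S \<in> sets ?B" by simp
      have "emeasure (distr (?A \<Otimes>\<^sub>M ?B) ?B snd) S = emeasure (?A \<Otimes>\<^sub>M ?B) (space ?A \<times> S)"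
        using S sets.sets_into_space[OF S]
        by (subst emeasure_distr) (auto simp: space_pair_measure intro!: arg_cong2[where f=emeasure])
      also have "\<dots> = emeasure ?B S"
        using S A.emeasure_space_1 by (subst B.emeasure_pair_measure_Times) auto
      finally show "emeasure (distr (?A \<Otimes>\<^sub>M ?B) ?B snd) S = emeasure ?B S" .
    qed simp
    finally show ?thesis .
  qed
  have m: "fst \<in> measurable (?A \<Otimes>\<^sub>M ?B) borel" "snd \<in> measurable (?A \<Otimes>\<^sub>M ?B) borel"
    using measurable_fst[of ?A ?B] measurable_snd[of ?A ?B]
    by (simp_all add: measurable_cong_sets[OF refl sets_density] measurable_lborel1)
  have e: "distr (?A \<Otimes>\<^sub>M ?B) lborel h = distr (?A \<Otimes>\<^sub>M ?B) borel h" for h :: "real \<times> real \<Rightarrow> real"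
    by (rule distr_cong) auto
  have s: "sets (?A \<Otimes>\<^sub>M ?B) = sets (borel \<Otimes>\<^sub>M borel)" by (rule sets_pair_measure_cong) auto
  have "AB.indep_var borel fst borel snd"
    unfolding AB.indep_var_distribution_eq 1 2
    using m by (simp add: distr_id2[OF s[symmetric]])
  then show ?thesis
    unfolding gaussian_noise_model_def distributed_def
    using m 1 2 f AB.prob_space_axioms by (simp add: e)
qed

definition normalized :: "(real \<Rightarrow> real) \<Rightarrow> real \<Rightarrow> real" where
  "normalized g x = g x / (\<integral>t. g t \<partial>lborel)"

definition cos_perturbed_gaussian :: "real \<Rightarrow> real \<Rightarrow> real \<Rightarrow> real \<Rightarrow> real \<Rightarrow> real" where
  "cos_perturbed_gaussian a \<rho> \<theta> \<omega> x =
     exp (- ((1 - a) / a) * (x\<^sup>2 / 2)) * (1 + \<rho> * cos (\<omega> * x / sqrt a + \<theta>))"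

definition hermite_prob :: "nat \<Rightarrow> real \<Rightarrow> real" where
  "hermite_prob m x = (-1) ^ m * exp (x\<^sup>2 / 2) * (deriv ^^ m) (\<lambda>t. exp (- t\<^sup>2 / 2)) x"

end

theory Submission
  imports Defs "HOL-Real_Asymp.Real_Asymp"
begin

text \<open>
  Given \<open>Y = y\<close>, the variable \<open>U = (X - a * y) / sqrt a\<close> has density proportional to
  \<open>\<phi> u * (1 + \<rho> * cos (\<omega> * u + \<psi>))\<close> with \<open>\<phi>\<close> the standard normal density and
  \<open>\<psi> = \<omega> * sqrt a * y + \<theta>\<close>. The conditional \<open>L\<^sup>p\<close> cost of a shift of \<open>U\<close> is strictly convex, and its
  derivative at \<open>0\<close> is a multiple of \<open>\<rho> * sin \<psi> * S \<omega>\<close>, where \<open>S \<omega>\<close> is the integral of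
  \<open>sgn u * \<bar>u\<bar> powr (p - 1) * sin (\<omega> * u) * \<phi> u\<close>. Hence \<open>a * y\<close> is optimal as soon as \<open>S \<omega> = 0\<close>.
  A zero of \<open>S\<close> exists because \<open>S\<close> is orthogonal to a weight of constant sign on \<open>(0, \<infinity>)\<close>. For even \<open>p\<close>,
  \<open>S\<close> is up to sign the \<open>(p - 1)\<close>-st derivative of the characteristic function
  \<open>exp (- \<omega>\<^sup>2 / 2)\<close>, that is, \<open>He (p - 1) \<omega> * exp (- \<omega>\<^sup>2 / 2)\<close>.
\<close>

section \<open>Powers of the absolute value and Gaussian integrals\<close>

text \<open>Away from 0 this is the power rule on a half-line; at 0 the difference quotient is
  bounded by \<open>\<bar>h\<bar> powr (q - 1)\<close>, which tends to 0 because
  \<open>1 < q\<close>.\<close>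

lemma DERIV_abs_powr:
  fixes q x :: real
  assumes "1 < q"
  shows "((\<lambda>x. \<bar>x\<bar> powr q) has_real_derivative q * (sgn x * \<bar>x\<bar> powr (q - 1))) (at x)"
proof (cases x "0::real" rule: linorder_cases)
  case less
  have "((\<lambda>x. (- x) powr q) has_real_derivative q * (sgn x * \<bar>x\<bar> powr (q - 1))) (at x)"
    using less by (auto intro!: derivative_eq_intros)
  then show ?thesis
    by (rule has_field_derivative_transform_within_open[where S="{..<0}"]) (use less in auto)
next
  case greater
  have "((\<lambda>x. x powr q) has_real_derivative q * (sgn x * \<bar>x\<bar> powr (q - 1))) (at x)"
    using greater by (auto intro!: derivative_eq_intros)
  then show ?thesis
    by (rule has_field_derivative_transform_within_open[where S="{0<..}"]) (use greater in auto)
next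
  case equal
  have l: "((\<lambda>h::real. \<bar>h\<bar> powr (q - 1)) \<longlongrightarrow> 0) (at 0)"
    using assms by (auto intro!: tendsto_eq_intros)
  have "((\<lambda>h::real. \<bar>h\<bar> powr q / h) \<longlongrightarrow> 0) (at 0)"
  proof (rule Lim_null_comparison[OF _ l])
    show "\<forall>\<^sub>F h in at 0. norm (\<bar>h\<bar> powr q / h) \<le> \<bar>h\<bar> powr (q - 1)"
      by (auto simp: eventually_at_filter powr_diff intro!: always_eventually)
  qed
  then show ?thesis using equal by (simp add: has_field_derivative_iff)
qed

lemma DERIV_sgn_abs_powr:
  fixes q x :: real
  assumes "1 < q"
  shows "((\<lambda>x. sgn x * \<bar>x\<bar> powr q) has_real_derivative q * \<bar>x\<bar> powr (q - 1)) (at x)"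
proof (cases x "0::real" rule: linorder_cases)
  case less
  have "((\<lambda>x. - ((- x) powr q)) has_real_derivative q * \<bar>x\<bar> powr (q - 1)) (at x)"
    using less by (auto intro!: derivative_eq_intros)
  then show ?thesis
    by (rule has_field_derivative_transform_within_open[where S="{..<0}"]) (use less in auto)
next
  case greater
  have "((\<lambda>x. x powr q) has_real_derivative q * \<bar>x\<bar> powr (q - 1)) (at x)"
    using greater by (auto intro!: derivative_eq_intros)
  then show ?thesis
    by (rule has_field_derivative_transform_within_open[where S="{0<..}"]) (use greater in auto)
next
  case equal
  have l: "((\<lambda>h::real. \<bar>h\<bar> powr (q - 1)) \<longlongrightarrow> 0) (at 0)"
    using assms by (auto intro!: tendsto_eq_intros)
  have "((\<lambda>h::real. sgn h * \<bar>h\<bar> powr q / h) \<longlongrightarrow> 0) (at 0)"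
  proof (rule Lim_null_comparison[OF _ l])
    show "\<forall>\<^sub>F h in at 0. norm (sgn h * \<bar>h\<bar> powr q / h) \<le> \<bar>h\<bar> powr (q - 1)"
      by (auto simp: eventually_at_filter powr_diff abs_mult abs_sgn_eq intro!: always_eventually)
  qed
  then show ?thesis using equal by (simp add: has_field_derivative_iff)
qed

text \<open>Up to a positive factor this function is the derivative of
  \<open>\<bar>x\<bar> powr (q + 1)\<close>, so its monotonicity is the source of all strict
  convexity below.\<close>

lemma sgn_abs_powr_strict_mono:
  fixes q s t :: real
  assumes "0 < q" "s < t"
  shows "sgn s * \<bar>s\<bar> powr q < sgn t * \<bar>t\<bar> powr q"
proof (cases "0 < s \<or> t < 0")
  case True
  then show ?thesis
    using assms powr_less_mono2[of q s t] powr_less_mono2[of q "- t" "- s"] by (auto simp: sgn_if)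
next
  case False
  then have *: "sgn s * \<bar>s\<bar> powr q \<le> 0" "0 \<le> sgn t * \<bar>t\<bar> powr q" "s < 0 \<or> 0 < t"
    using assms by (auto simp: sgn_if)
  have "sgn s * \<bar>s\<bar> powr q < 0 \<or> 0 < sgn t * \<bar>t\<bar> powr q"
    using *(3) by auto
  then show ?thesis using *(1,2) by linarith
qed

text \<open>Strict convexity in tangent form: the mean value theorem gives a slope at a point
  strictly between \<open>s\<close> and \<open>t\<close>, and strict monotonicity compares it with
  the slope at \<open>t\<close>. This form can be integrated against a weight.\<close>

lemma abs_powr_above_tangent:
  fixes p s t :: real
  assumes "1 < p" "s \<noteq> t"
  shows "\<bar>t\<bar> powr p + p * (s - t) * (sgn t * \<bar>t\<bar> powr (p - 1)) < \<bar>s\<bar> powr p"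
proof -
  let ?d = "\<lambda>x::real. sgn x * \<bar>x\<bar> powr (p - 1)"
  have D: "((\<lambda>x. \<bar>x\<bar> powr p) has_real_derivative p * ?d x) (at x)" for x
    by (rule DERIV_abs_powr) fact
  show ?thesis
  proof (cases "s < t")
    case True
    obtain z where z: "s < z" "z < t" "\<bar>t\<bar> powr p - \<bar>s\<bar> powr p = (t - s) * (p * ?d z)"
      using MVT2[OF True, of "\<lambda>x. \<bar>x\<bar> powr p" "\<lambda>x. p * ?d x"] D by blast
    have "(t - s) * (p * ?d z) < (t - s) * (p * ?d t)"
      using sgn_abs_powr_strict_mono[of "p - 1" z t] z assms True by simp
    then show ?thesis using z by (simp add: algebra_simps)
  next
    case False
    then have "t < s" using assms by simp
    then obtain z where z: "t < z" "z < s" "\<bar>s\<bar> powr p - \<bar>t\<bar> powr p = (s - t) * (p * ?d z)"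
      using MVT2[of t s "\<lambda>x. \<bar>x\<bar> powr p" "\<lambda>x. p * ?d x"] D by blast
    have "(s - t) * (p * ?d t) < (s - t) * (p * ?d z)"
      using sgn_abs_powr_strict_mono[of "p - 1" t z] z assms \<open>t < s\<close> by simp
    then show ?thesis using z by (simp add: algebra_simps)
  qed
qed

text \<open>Estimating by twice the maximum, instead of by convexity, covers exponents below 1 as
  well.\<close>

lemma abs_powr_diff_le:
  fixes q u v :: real
  assumes "0 \<le> q"
  shows "\<bar>u - v\<bar> powr q \<le> 2 powr q * (\<bar>u\<bar> powr q + \<bar>v\<bar> powr q)"
proof -
  have "\<bar>u - v\<bar> powr q \<le> (2 * max \<bar>u\<bar> \<bar>v\<bar>) powr q"
    using assms by (intro powr_mono2) auto
  also have "\<dots> = 2 powr q * (max \<bar>u\<bar> \<bar>v\<bar>) powr q" by (simp add: powr_mult)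
  also have "\<dots> \<le> 2 powr q * (\<bar>u\<bar> powr q + \<bar>v\<bar> powr q)"
    by (intro mult_left_mono) (auto simp: max_def)
  finally show ?thesis .
qed

section \<open>Gaussian moments and differentiation under the integral sign\<close>

lemma integrable_abs_powr_normal:
  fixes q :: real
  assumes "0 \<le> q"
  shows "integrable lborel (\<lambda>u. \<bar>u\<bar> powr q * std_normal_density u)"
proof (rule Bochner_Integration.integrable_bound)
  let ?N = "nat \<lceil>q\<rceil>"
  show "integrable lborel (\<lambda>u. std_normal_density u + std_normal_density u * \<bar>u\<bar> ^ ?N)"
    by (intro Bochner_Integration.integrable_add integrable_std_normal_moment_abs) simp
  \<comment> \<open>Reduction to an integer moment: inside the unit interval the power is at most 1,
    outside it rounding the exponent up only increases it.\<close>
  have "\<bar>u\<bar> powr q \<le> 1 + \<bar>u\<bar> ^ ?N" for u :: real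
  proof (cases "\<bar>u\<bar> \<le> 1")
    case True
    then have "\<bar>u\<bar> powr q \<le> 1" using assms by (auto intro: powr_le1)
    then show ?thesis by (meson add_increasing2 zero_le_power abs_ge_zero)
  next
    case False
    then have "\<bar>u\<bar> powr q \<le> \<bar>u\<bar> powr real ?N" using assms by (intro powr_mono) linarith+
    also have "\<dots> = \<bar>u\<bar> ^ ?N" using False by (intro powr_realpow) auto
    finally show ?thesis by simp
  qed
  then show "AE u in lborel. norm (\<bar>u\<bar> powr q * std_normal_density u)
      \<le> norm (std_normal_density u + std_normal_density u * \<bar>u\<bar> ^ ?N)"
    by (intro AE_I2)
      (simp add: abs_mult, metis mult.commute mult_left_mono normal_density_nonneg distrib_left mult.right_neutral)
qed simp

lemma integrable_abs_powr_diff_normal: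
  fixes q :: real
  assumes "0 \<le> q"
  shows "integrable lborel (\<lambda>u. \<bar>u - v\<bar> powr q * std_normal_density u)"
proof (rule Bochner_Integration.integrable_bound)
  show "integrable lborel (\<lambda>u. 2 powr q * (\<bar>u\<bar> powr q * std_normal_density u +
      \<bar>v\<bar> powr q * std_normal_density u))"
    by (intro integrable_mult_right Bochner_Integration.integrable_add integrable_abs_powr_normal assms) auto
  show "AE u in lborel. norm (\<bar>u - v\<bar> powr q * std_normal_density u)
      \<le> norm (2 powr q * (\<bar>u\<bar> powr q * std_normal_density u + \<bar>v\<bar> powr q * std_normal_density u))"
    using mult_right_mono[OF abs_powr_diff_le[OF assms, of _ v] normal_density_nonneg]
    by (intro AE_I2) (simp add: abs_mult algebra_simps)
qed simp

text \<open>The bound \<open>g\<close> on the derivative bounds every difference quotient by the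
  mean value inequality, so dominated convergence applies along any sequence approaching
  \<open>x\<close>.\<close>

lemma DERIV_lebesgue_integral:
  fixes f f' :: "real \<Rightarrow> 'a \<Rightarrow> real"
  assumes f: "\<And>x. integrable M (f x)" and g: "integrable M g"
    and f'[measurable]: "\<And>x. f' x \<in> borel_measurable M"
    and D: "\<And>x u. ((\<lambda>x. f x u) has_real_derivative f' x u) (at x)"
    and le: "\<And>x u. \<bar>f' x u\<bar> \<le> g u"
  shows "((\<lambda>x. \<integral>u. f x u \<partial>M) has_real_derivative (\<integral>u. f' x u \<partial>M)) (at x)"
  unfolding has_field_derivative_iff tendsto_at_iff_sequentially comp_def
proof (intro allI impI)
  fix X :: "nat \<Rightarrow> real" assume X: "\<forall>i. X i \<in> UNIV - {x}" "X \<longlonglongrightarrow> x"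
  have [measurable]: "f y \<in> borel_measurable M" for y using f by blast
  have "(\<lambda>i. \<integral>u. (f (X i) u - f x u) / (X i - x) \<partial>M) \<longlonglongrightarrow> (\<integral>u. f' x u \<partial>M)"
  proof (rule integral_dominated_convergence[OF _ _ g])
    show "AE u in M. (\<lambda>i. (f (X i) u - f x u) / (X i - x)) \<longlonglongrightarrow> f' x u"
    proof (intro AE_I2)
      fix u
      show "(\<lambda>i. (f (X i) u - f x u) / (X i - x)) \<longlonglongrightarrow> f' x u"
        using D[of u x] X unfolding has_field_derivative_iff tendsto_at_iff_sequentially comp_def by blast
    qed
    show "AE u in M. norm ((f (X i) u - f x u) / (X i - x)) \<le> g u" for i
    proof (intro AE_I2)
      fix u
      have "\<bar>f (X i) u - f x u\<bar> \<le> g u * \<bar>X i - x\<bar>"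
        using field_differentiable_bound[of UNIV "\<lambda>x. f x u" "\<lambda>x. f' x u" "g u" "X i" x] D le by auto
      then show "norm ((f (X i) u - f x u) / (X i - x)) \<le> g u"
        using X by (simp add: field_simps abs_mult)
    qed
  qed simp_all
  also have "(\<lambda>i. \<integral>u. (f (X i) u - f x u) / (X i - x) \<partial>M)
      = (\<lambda>i. ((\<integral>u. f (X i) u \<partial>M) - (\<integral>u. f x u \<partial>M)) / (X i - x))"
    using f by simp
  finally show "(\<lambda>i. ((\<integral>u. f (X i) u \<partial>M) - (\<integral>u. f x u \<partial>M)) / (X i - x)) \<longlonglongrightarrow> (\<integral>u. f' x u \<partial>M)" .
qed

lemma integrable_normal_bounded:
  fixes h b :: "real \<Rightarrow> real"
  assumes "integrable lborel (\<lambda>u. h u * std_normal_density u)"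
    and [measurable]: "b \<in> borel_measurable borel" and "\<And>u. \<bar>b u\<bar> \<le> B"
  shows "integrable lborel (\<lambda>u. h u * std_normal_density u * b u)"
proof (rule Bochner_Integration.integrable_bound)
  show "integrable lborel (\<lambda>u. B * (h u * std_normal_density u))" using assms by simp
  show "AE u in lborel. norm (h u * std_normal_density u * b u) \<le> norm (B * (h u * std_normal_density u))"
    using assms(3) order_trans[OF assms(3) abs_ge_self]
    by (intro AE_I2) (auto simp: abs_mult mult.commute[of "\<bar>B\<bar>"] intro!: mult_left_mono)
  show "(\<lambda>u. h u * std_normal_density u * b u) \<in> borel_measurable lborel"
    using borel_measurable_integrable[OF assms(1)] by simp
qed

text \<open>The \<open>k\<close>-th derivative of the standard normal characteristic function: the
  phase \<open>k * (pi / 2)\<close> records that each differentiation of the cosine advances it by a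
  quarter turn.\<close>

definition normal_moment_cos :: "nat \<Rightarrow> real \<Rightarrow> real" where
  "normal_moment_cos k x = (\<integral>u. u ^ k * std_normal_density u * cos (x * u + k * (pi / 2)) \<partial>lborel)"

lemma integrable_normal_moment_cos:
  "integrable lborel (\<lambda>u. u ^ k * std_normal_density u * cos (x * u + c))"
  using integrable_std_normal_moment[of k]
  by (intro integrable_normal_bounded[where B=1]) (simp_all add: mult.commute)

lemma DERIV_normal_moment_cos:
  "(normal_moment_cos k has_real_derivative normal_moment_cos (Suc k) x) (at x)"
  unfolding normal_moment_cos_def[abs_def]
proof (rule DERIV_lebesgue_integral)
  show "integrable lborel (\<lambda>u. u ^ k * std_normal_density u * cos (x * u + k * (pi / 2)))" for x
    by (rule integrable_normal_moment_cos)
  show "integrable lborel (\<lambda>u. std_normal_density u * \<bar>u\<bar> ^ Suc k)"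
    by (rule integrable_std_normal_moment_abs)
  show "((\<lambda>x. u ^ k * std_normal_density u * cos (x * u + k * (pi / 2))) has_real_derivative
      u ^ Suc k * std_normal_density u * cos (x * u + Suc k * (pi / 2))) (at x)" for x u
  proof -
    have "cos (x * u + Suc k * (pi / 2)) = - sin (x * u + k * (pi / 2))"
      by (simp add: cos_add sin_add add_divide_distrib distrib_right)
    then show ?thesis by (auto intro!: derivative_eq_intros)
  qed
  show "\<bar>u ^ Suc k * std_normal_density u * cos (x * u + Suc k * (pi / 2))\<bar>
      \<le> std_normal_density u * \<bar>u\<bar> ^ Suc k" for x u
    using mult_left_mono[OF abs_cos_le_one, of "\<bar>u ^ Suc k * std_normal_density u\<bar>" "x * u + Suc k * (pi / 2)"]
    by (simp add: abs_mult power_abs mult_ac)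
qed measurable

text \<open>Real part of the characteristic function of the standard normal distribution.\<close>

lemma normal_moment_cos_0: "normal_moment_cos 0 x = exp (- x\<^sup>2 / 2)"
proof -
  have "integrable lborel (\<lambda>u. std_normal_density u *\<^sub>R iexp (x * u))"
    by (rule Bochner_Integration.integrable_bound[OF integrable_normal_density[of 1 0]])
      (auto simp: norm_mult)
  then have "Re (CLINT u|lborel. std_normal_density u *\<^sub>R iexp (x * u))
      = (\<integral>u. Re (std_normal_density u *\<^sub>R iexp (x * u)) \<partial>lborel)"
    by (rule integral_Re[symmetric])
  moreover have "(CLINT u|lborel. std_normal_density u *\<^sub>R iexp (x * u)) = exp (- x\<^sup>2 / 2)"
    using fun_cong[OF char_std_normal_distribution, of x]
    by (simp add: char_def integral_density)
  ultimately show ?thesis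
    by (simp add: normal_moment_cos_def Re_exp)
qed

lemma deriv_exp_normal_moment_cos:
  "(deriv ^^ k) (\<lambda>t. exp (- t\<^sup>2 / 2)) = normal_moment_cos k"
proof (induction k)
  case 0
  show ?case by (rule ext) (simp add: normal_moment_cos_0)
next
  case (Suc k)
  then show ?case using DERIV_imp_deriv[OF DERIV_normal_moment_cos] by auto
qed

section \<open>Zeros of the sine moment\<close>

definition sgn_moment_sin :: "real \<Rightarrow> real \<Rightarrow> real" where
  "sgn_moment_sin q x = (\<integral>u. sgn u * \<bar>u\<bar> powr q * std_normal_density u * sin (x * u) \<partial>lborel)"

lemma integrable_sgn_abs_powr_normal:
  fixes q :: real
  assumes "0 \<le> q"
  shows "integrable lborel (\<lambda>u. sgn u * \<bar>u\<bar> powr q * std_normal_density u)"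
  by (rule Bochner_Integration.integrable_bound[OF integrable_abs_powr_normal[OF assms]])
    (auto simp: abs_mult abs_sgn_eq)

text \<open>Obtained from differentiability: differentiating in \<open>x\<close> costs one more
  power of \<open>\<bar>u\<bar>\<close>, which is still integrable against the normal density.
  Continuity is what the intermediate value theorem needs later.\<close>

lemma isCont_sgn_moment_sin:
  assumes "0 \<le> q"
  shows "isCont (sgn_moment_sin q) x"
proof -
  have "((\<lambda>x. \<integral>u. sgn u * \<bar>u\<bar> powr q * std_normal_density u * sin (x * u) \<partial>lborel) has_real_derivative
      (\<integral>u. sgn u * \<bar>u\<bar> powr q * std_normal_density u * (u * cos (x * u)) \<partial>lborel)) (at x)"
  proof (rule DERIV_lebesgue_integral)
    show "integrable lborel (\<lambda>u. sgn u * \<bar>u\<bar> powr q * std_normal_density u * sin (x * u))" for x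
      by (rule integrable_normal_bounded[where B=1, OF integrable_sgn_abs_powr_normal]) (use assms in auto)
    show "integrable lborel (\<lambda>u. \<bar>u\<bar> powr (q + 1) * std_normal_density u)"
      by (rule integrable_abs_powr_normal) (use assms in auto)
    show "((\<lambda>x. sgn u * \<bar>u\<bar> powr q * std_normal_density u * sin (x * u)) has_real_derivative
        sgn u * \<bar>u\<bar> powr q * std_normal_density u * (u * cos (x * u))) (at x)" for x u
      by (auto intro!: derivative_eq_intros)
    have le: "\<bar>sgn u\<bar> * \<bar>u\<bar> powr q * (\<bar>u\<bar> * \<bar>cos y\<bar>) \<le> \<bar>u\<bar> powr (q + 1)" for u y :: real
      by (simp add: abs_sgn_eq powr_add mult_left_le mult_left_mono)
    show "\<bar>sgn u * \<bar>u\<bar> powr q * std_normal_density u * (u * cos (x * u))\<bar>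
        \<le> \<bar>u\<bar> powr (q + 1) * std_normal_density u" for x u
      using mult_right_mono[OF le[of u "x * u"] normal_density_nonneg[of 0 1 u]]
      by (simp add: abs_mult mult_ac)
  qed measurable
  then show ?thesis unfolding sgn_moment_sin_def[abs_def] by (rule DERIV_isCont)
qed

lemma sgn_moment_sin_minus: "sgn_moment_sin q (- x) = - sgn_moment_sin q x"
  by (simp add: sgn_moment_sin_def)

text \<open>For even \<open>n\<close> the exponent \<open>n - 1\<close> is odd, so the signed power
  is \<open>u ^ (n - 1)\<close>, and the phase \<open>(n - 1) * (pi / 2)\<close> turns the cosine
  into plus or minus the sine. Hence the sine moment is, up to sign, the derivative occurring in
  \<open>hermite_prob\<close>, whose exponential factor never vanishes.\<close>

lemma sgn_moment_sin_even_iff_hermite: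
  assumes "even n" "0 < n"
  shows "sgn_moment_sin (real n - 1) x = 0 \<longleftrightarrow> hermite_prob (n - 1) x = 0"
proof -
  obtain j where n: "n = 2 * j + 2"
  proof -
    obtain i where i: "n = 2 * i" using \<open>even n\<close> by (rule evenE)
    \<comment> \<open>Positivity of \<open>n\<close> gives \<open>1 \<le> i\<close>, so the
      subtraction is not truncated.\<close>
    then have "n = 2 * (i - 1) + 2" using \<open>0 < n\<close> by simp
    then show ?thesis by (rule that)
  qed
  have *: "u ^ (n - 1) * std_normal_density u * cos (x * u + real (n - 1) * (pi / 2))
      = - ((-1) ^ j) * (sgn u * \<bar>u\<bar> powr (real n - 1) * std_normal_density u * sin (x * u))" for u
  proof -
    have "sgn u * \<bar>u\<bar> powr (real n - 1) = u ^ (n - 1)"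
    proof (cases "u = 0")
      case False
      then have "\<bar>u\<bar> powr (real n - 1) = \<bar>u\<bar> ^ (n - 1)"
        using n powr_realpow[of "\<bar>u\<bar>" "n - 1"] by simp
      then show ?thesis using n False by (simp add: sgn_if power_minus_odd power_minus_even)
    qed (simp add: n)
    moreover have "cos (x * u + real (n - 1) * (pi / 2)) = - ((-1) ^ j) * sin (x * u)"
    proof -
      have "x * u + real (n - 1) * (pi / 2) = (x * u + pi / 2) + real j * pi" by (simp add: n field_simps)
      moreover have "cos (y + real j * pi) = (-1) ^ j * cos y" for y
        
      proof (induction j)
        case (Suc j)
        have "y + real (Suc j) * pi = (y + real j * pi) + pi" by (simp add: algebra_simps)
        then show ?case using Suc by (simp only: cos_periodic_pi power_Suc)
      qed simp
      ultimately show ?thesis by (simp only:) (simp add: cos_add)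
    qed
    ultimately show ?thesis by simp
  qed
  have "normal_moment_cos (n - 1) x = - ((-1) ^ j) * sgn_moment_sin (real n - 1) x"
    unfolding normal_moment_cos_def sgn_moment_sin_def * by simp
  then show ?thesis unfolding hermite_prob_def deriv_exp_normal_moment_cos by simp
qed

text \<open>The substitution \<open>x = v / sqrt t\<close> yields the third cosine moment at
  \<open>u / sqrt t\<close>, that is, the third derivative
  \<open>(3 * y - y ^ 3) * exp (- y\<^sup>2 / 2)\<close> of the Gaussian.\<close>

lemma integral_sin_cubic_exp:
  fixes t u :: real
  assumes "0 < t"
  shows "(\<integral>x. x ^ 3 * exp (- t * x\<^sup>2 / 2) * sin (x * u) \<partial>lborel)
    = sqrt (2 * pi) / (t ^ 2 * sqrt t) * (3 * u - u ^ 3 / t) * exp (- u\<^sup>2 / (2 * t))"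
proof -
  have D: "((\<lambda>x. exp (- x\<^sup>2 / 2)) has_real_derivative - x * exp (- x\<^sup>2 / 2)) (at x)" for x :: real
    by (auto intro!: derivative_eq_intros)
  have 1: "deriv (\<lambda>x. exp (- x\<^sup>2 / 2)) = (\<lambda>x::real. - x * exp (- x\<^sup>2 / 2))"
    using D by (intro ext DERIV_imp_deriv)
  have 2: "deriv (\<lambda>x. - x * exp (- x\<^sup>2 / 2)) = (\<lambda>x::real. (x\<^sup>2 - 1) * exp (- x\<^sup>2 / 2))"
    by (intro ext DERIV_imp_deriv) (auto intro!: derivative_eq_intros simp: algebra_simps power2_eq_square)
  have 3: "deriv (\<lambda>x. (x\<^sup>2 - 1) * exp (- x\<^sup>2 / 2)) = (\<lambda>x::real. (3 * x - x ^ 3) * exp (- x\<^sup>2 / 2))"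
    by (intro ext DERIV_imp_deriv) (auto intro!: derivative_eq_intros simp: algebra_simps power2_eq_square power3_eq_cube)
  have M: "normal_moment_cos 3 y = (3 * y - y ^ 3) * exp (- y\<^sup>2 / 2)" for y
  proof -
    have "normal_moment_cos 3 = deriv (deriv (deriv (\<lambda>x. exp (- x\<^sup>2 / 2))))"
      unfolding deriv_exp_normal_moment_cos[symmetric] by (simp add: numeral_3_eq_3)
    then show ?thesis unfolding 1 2 3 by simp
  qed
  have s: "sqrt t > 0" "sqrt t ^ 2 = t" using assms by auto
  have c: "cos (y + 3 * (pi / 2)) = sin y" for y
  proof -
    have "y + 3 * (pi / 2) = (y + pi / 2) + pi" by simp
    then show ?thesis by (simp only: cos_periodic_pi) (simp add: cos_add)
  qed
  have e: "(0 + 1 / sqrt t * v) ^ 3 * exp (- t * (0 + 1 / sqrt t * v)\<^sup>2 / 2) * sin ((0 + 1 / sqrt t * v) * u)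
      = sqrt (2 * pi) / sqrt t ^ 3 * (v ^ 3 * std_normal_density v * sin (u / sqrt t * v))" for v
  proof -
    have "- t * (0 + 1 / sqrt t * v)\<^sup>2 / 2 = - v\<^sup>2 / 2" using s assms by (simp add: power_divide)
    then show ?thesis using s by (simp add: std_normal_density_def power_divide mult_ac)
  qed
  have "(\<integral>x. x ^ 3 * exp (- t * x\<^sup>2 / 2) * sin (x * u) \<partial>lborel)
      = \<bar>1 / sqrt t\<bar> * (\<integral>v. (0 + 1 / sqrt t * v) ^ 3 * exp (- t * (0 + 1 / sqrt t * v)\<^sup>2 / 2) * sin ((0 + 1 / sqrt t * v) * u) \<partial>lborel)"
    by (subst lborel_integral_real_affine[where c="1 / sqrt t" and t=0]) (use s in auto)
  also have "\<dots> = 1 / sqrt t * (\<integral>v. sqrt (2 * pi) / sqrt t ^ 3 * (v ^ 3 * std_normal_density v * cos (u / sqrt t * v + 3 * (pi / 2))) \<partial>lborel)"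
    using s unfolding c e by simp
  also have "\<dots> = 1 / sqrt t * (sqrt (2 * pi) / sqrt t ^ 3 * normal_moment_cos 3 (u / sqrt t))"
    unfolding normal_moment_cos_def by simp
  also have "\<dots> = sqrt (2 * pi) / (t ^ 2 * sqrt t) * (3 * u - u ^ 3 / t) * exp (- u\<^sup>2 / (2 * t))"
  proof -
    have "1 / r * (1 / r ^ 3 * (3 * (u / r) - (u / r) ^ 3)) = 1 / ((r ^ 2) ^ 2 * r) * (3 * u - u ^ 3 / r ^ 2)"
      if "0 < r" for r :: real
      using that by (simp add: field_simps eval_nat_numeral)
    from this[of "sqrt t"]
    have E: "1 / sqrt t * (1 / sqrt t ^ 3 * (3 * (u / sqrt t) - (u / sqrt t) ^ 3)) = 1 / (t ^ 2 * sqrt t) * (3 * u - u ^ 3 / t)"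
      using s by simp
    have "exp (- (u / sqrt t)\<^sup>2 / 2) = exp (- u\<^sup>2 / (2 * t))" using s by (simp add: power_divide mult.commute)
    then have "1 / sqrt t * (sqrt (2 * pi) / sqrt t ^ 3 * normal_moment_cos 3 (u / sqrt t))
        = sqrt (2 * pi) * (1 / sqrt t * (1 / sqrt t ^ 3 * (3 * (u / sqrt t) - (u / sqrt t) ^ 3))) * exp (- u\<^sup>2 / (2 * t))"
      unfolding M by simp
    then show ?thesis unfolding E by simp
  qed
  finally show ?thesis .
qed

lemma exp_square_eq_normal_density:
  fixes t x :: real
  assumes "0 < t"
  shows "exp (- t * x\<^sup>2 / 2) = sqrt (2 * pi / t) * normal_density 0 (1 / sqrt t) x"
  using assms by (simp add: normal_density_def power_divide real_sqrt_divide real_sqrt_mult)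

lemma integrable_exp_square_power:
  fixes t :: real
  assumes "0 < t"
  shows "integrable lborel (\<lambda>x. \<bar>x\<bar> ^ k * exp (- t * x\<^sup>2 / 2))"
proof -
  have "integrable lborel (\<lambda>x. sqrt (2 * pi / t) * (normal_density 0 (1 / sqrt t) x * \<bar>x - 0\<bar> ^ k))"
    by (intro integrable_mult_right integrable_normal_moment_abs) (use assms in simp)
  then show ?thesis unfolding exp_square_eq_normal_density[OF assms] by (simp add: mult_ac)
qed

lemma (in pair_sigma_finite) integrable_product:
  fixes f :: "'a \<Rightarrow> real" and g :: "'b \<Rightarrow> real"
  assumes f: "integrable M1 f" and g: "integrable M2 g"
  shows "integrable (M1 \<Otimes>\<^sub>M M2) (\<lambda>(x, y). f x * g y)"
proof (rule Fubini_integrable)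
  have [measurable]: "f \<in> borel_measurable M1" "g \<in> borel_measurable M2" using f g by auto
  show "(\<lambda>(x, y). f x * g y) \<in> borel_measurable (M1 \<Otimes>\<^sub>M M2)" by measurable
  show "integrable M1 (\<lambda>x. \<integral>y. norm (case (x, y) of (x, y) \<Rightarrow> f x * g y) \<partial>M2)"
    using f by (simp add: abs_mult)
  show "AE x in M1. integrable M2 (\<lambda>y. case (x, y) of (x, y) \<Rightarrow> f x * g y)"
    using g by simp
qed

text \<open>The integrand is the derivative of a function \<open>F\<close> vanishing at both
  infinities. Matching coefficients requires \<open>(p + 1) / (t + 1) = 3\<close> and
  \<open>b / (t + 1) = 1 / t\<close>: the first dictates \<open>t = (p - 2) / 3\<close>, positive
  because \<open>2 < p\<close>, and the second holds for \<open>b = 1 + 1 / t\<close>.\<close>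

lemma integral_sgn_abs_powr_cubic_exp:
  fixes p t :: real
  assumes "2 < p" and t: "t = (p - 2) / 3"
  shows "(\<integral>u. sgn u * \<bar>u\<bar> powr (p - 1) * (3 * u - u ^ 3 / t) * exp (- (1 + 1 / t) * u\<^sup>2 / 2) \<partial>lborel) = 0"
    (is "(\<integral>u. ?f u \<partial>lborel) = 0")
proof -
  define b where "b = 1 + 1 / t"
  have t0: "0 < t" and p: "p + 1 = 3 * (t + 1)" and bt: "b = (t + 1) / t" and b: "0 < b"
    using assms by (auto simp: b_def field_simps)
  define F where "F = (\<lambda>u. sgn u * \<bar>u\<bar> powr (p + 1) * exp (- b * u\<^sup>2 / 2) / (t + 1))"
  have f_eq: "?f u = (3 * \<bar>u\<bar> powr p - \<bar>u\<bar> powr (p + 2) / t) * exp (- b * u\<^sup>2 / 2)" for u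
  proof -
    have "sgn u * \<bar>u\<bar> powr (p - 1) * u = \<bar>u\<bar> powr p"
      by (cases "u = 0") (simp_all add: powr_diff sgn_if)
    moreover have "\<bar>u\<bar> powr p * u ^ 2 = \<bar>u\<bar> powr (p + 2)"
      by (cases "u = 0") (simp_all add: powr_add powr_numeral)
    ultimately have "sgn u * \<bar>u\<bar> powr (p - 1) * (3 * u - u ^ 3 / t) = 3 * \<bar>u\<bar> powr p - \<bar>u\<bar> powr (p + 2) / t"
      by (simp add: algebra_simps power2_eq_square power3_eq_cube)
    then show ?thesis by (simp add: b_def)
  qed
  have F: "(F has_real_derivative ?f u) (at u)" for u
  proof -
    have "(F has_real_derivative ((p + 1) * \<bar>u\<bar> powr p * exp (- b * u\<^sup>2 / 2)
        + sgn u * \<bar>u\<bar> powr (p + 1) * (exp (- b * u\<^sup>2 / 2) * (- b * u))) / (t + 1)) (at u)"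
      unfolding F_def using assms(1) t0
      by (auto intro!: derivative_eq_intros DERIV_sgn_abs_powr[of "p + 1", THEN DERIV_cong])
    also have "sgn u * \<bar>u\<bar> powr (p + 1) * (exp (- b * u\<^sup>2 / 2) * (- b * u))
        = - b * \<bar>u\<bar> powr (p + 2) * exp (- b * u\<^sup>2 / 2)"
      by (cases "u = 0") (simp_all add: powr_add powr_numeral sgn_if power2_eq_square)
    also have "((p + 1) * \<bar>u\<bar> powr p * exp (- b * u\<^sup>2 / 2) + - b * \<bar>u\<bar> powr (p + 2) * exp (- b * u\<^sup>2 / 2)) / (t + 1)
        = ?f u"
      unfolding f_eq p using t0 unfolding bt by (simp add: divide_simps) (simp add: algebra_simps)
    finally show ?thesis .
  qed
  have int: "integrable lborel ?f"
  proof -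
    \<comment> \<open>Of \<open>exp (- b * u\<^sup>2 / 2)\<close>, the part with coefficient 1 is
      the normal density up to a constant, and the remaining factor is bounded by 1.\<close>
    have J: "integrable lborel (\<lambda>u. (\<bar>u\<bar> powr q * std_normal_density u) * exp (- (1 / t) * u\<^sup>2 / 2))" if "0 \<le> q" for q :: real
      by (intro integrable_normal_bounded[where B=1] integrable_abs_powr_normal that) (use t0 in auto)
    have "integrable lborel (\<lambda>u. sqrt (2 * pi) * (3 * ((\<bar>u\<bar> powr p * std_normal_density u) * exp (- (1 / t) * u\<^sup>2 / 2))
        - 1 / t * ((\<bar>u\<bar> powr (p + 2) * std_normal_density u) * exp (- (1 / t) * u\<^sup>2 / 2))))"
      using assms(1) by (intro integrable_mult_right Bochner_Integration.integrable_diff J) simp_all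
    also have "(\<lambda>u. sqrt (2 * pi) * (3 * ((\<bar>u\<bar> powr p * std_normal_density u) * exp (- (1 / t) * u\<^sup>2 / 2))
        - 1 / t * ((\<bar>u\<bar> powr (p + 2) * std_normal_density u) * exp (- (1 / t) * u\<^sup>2 / 2)))) = ?f"
    proof
      fix u
      have "exp (- b * u\<^sup>2 / 2) = exp (- u\<^sup>2 / 2) * exp (- (1 / t) * u\<^sup>2 / 2)"
        using t0 by (simp add: b_def field_simps flip: exp_add)
      then show "sqrt (2 * pi) * (3 * ((\<bar>u\<bar> powr p * std_normal_density u) * exp (- (1 / t) * u\<^sup>2 / 2))
        - 1 / t * ((\<bar>u\<bar> powr (p + 2) * std_normal_density u) * exp (- (1 / t) * u\<^sup>2 / 2))) = ?f u"
        unfolding f_eq by (simp add: std_normal_density_def algebra_simps)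
    qed
    finally show ?thesis .
  qed
  have top: "(F \<longlongrightarrow> 0) at_top"
  proof -
    have "((\<lambda>u. u powr (p + 1) * exp (- b * u\<^sup>2 / 2) / (t + 1)) \<longlongrightarrow> 0) at_top"
      using b t0 by real_asymp
    then show ?thesis
      by (rule Lim_transform_eventually) (auto simp: F_def intro: eventually_mono[OF eventually_gt_at_top[of 0]])
  qed
  have "F (- u) = - F u" for u by (simp add: F_def sgn_minus)
  then have bot: "(F \<longlongrightarrow> 0) at_bot"
    using tendsto_minus[OF top] by (simp add: filterlim_at_bot_mirror)
  have "(LBINT u=-\<infinity>..\<infinity>. ?f u) = 0 - 0"
  proof (rule interval_integral_FTC_integrable)
    show "(F has_vector_derivative ?f u) (at u)" for u
      using F has_real_derivative_iff_has_vector_derivative by blast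
    show "isCont ?f u" for u
    proof -
      have c: "isCont (\<lambda>u. \<bar>u\<bar> powr q) u" if "1 < q" for q :: real
        using DERIV_abs_powr[OF that] by (rule DERIV_isCont)
      show ?thesis
        unfolding f_eq[abs_def] using assms(1) t0
        by (intro isCont_mult isCont_diff isCont_divide c) simp_all
    qed
    show "set_integrable lborel (einterval (- \<infinity>) \<infinity>) ?f"
      using int by (simp add: set_integrable_def)
    show "((F \<circ> real_of_ereal) \<longlongrightarrow> 0) (at_right (- \<infinity>))"
      using bot by (simp add: ereal_tendsto_simps)
    show "((F \<circ> real_of_ereal) \<longlongrightarrow> 0) (at_left \<infinity>)"
      using top by (simp add: ereal_tendsto_simps)
  qed simp
  then show ?thesis
    by (simp add: interval_lebesgue_integral_def set_lebesgue_integral_def)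
qed

text \<open>
  If \<open>sgn_moment_sin (p - 1)\<close> had no zero on \<open>(0, \<infinity>)\<close>, its integral against
  \<open>x ^ 3 * exp (- t * x\<^sup>2 / 2)\<close> would not vanish. For \<open>t = (p - 2) / 3\<close> it does: exchanging
  the integrals leaves the derivative of \<open>sgn u * \<bar>u\<bar> powr (p + 1) * exp (- (1 + 1 / t) * u\<^sup>2 / 2)\<close>.
\<close>
lemma ex_sgn_moment_sin_zero:
  fixes p :: real
  assumes "2 < p"
  shows "\<exists>x>0. sgn_moment_sin (p - 1) x = 0"
proof (rule ccontr)
  let ?S = "sgn_moment_sin (p - 1)"
  assume "\<not> (\<exists>x>0. ?S x = 0)"
  then have nz: "?S x \<noteq> 0" if "0 < x" for x using that by blast
  have cont: "isCont ?S x" for x using assms by (intro isCont_sgn_moment_sin) simp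
  \<comment> \<open>Without a zero, the intermediate value theorem keeps the sign constant on the
    positive axis; multiplying by \<open>?S 1\<close> treats both possible signs at once.\<close>
  have same_sign: "0 < ?S x * ?S 1" if "0 < x" for x
  proof (rule ccontr)
    assume "\<not> 0 < ?S x * ?S 1"
    then have "(?S x \<le> 0 \<and> 0 \<le> ?S 1) \<or> (0 \<le> ?S x \<and> ?S 1 \<le> 0)"
      by (auto simp: zero_less_mult_iff not_less)
    moreover have "continuous_on {min x 1..max x 1} ?S"
      using cont by (intro continuous_at_imp_continuous_on) blast
    ultimately have "\<exists>z\<ge>min x 1. z \<le> max x 1 \<and> ?S z = 0"
      using IVT'[of ?S "min x 1" 0 "max x 1"] IVT2'[of ?S "max x 1" 0 "min x 1"]
      by (cases "x \<le> 1") (auto simp: min_def max_def)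
    then show False using nz that by (metis min_less_iff_conj less_le_trans zero_less_one)
  qed
  define t where "t = (p - 2) / 3"
  have t0: "0 < t" using assms by (simp add: t_def)
  \<comment> \<open>The weight is odd, like \<open>?S\<close>, so their product is even and the
    integral may run over the whole line. The power 3 matters: the sine transform of
    \<open>x * exp (- t * x\<^sup>2 / 2)\<close> has constant sign on the positive axis, whereas the
    cubic weight produces the sign change of \<open>3 * u - u ^ 3 / t\<close>.\<close>
  define g where "g = (\<lambda>x::real. x ^ 3 * exp (- t * x\<^sup>2 / 2))"
  define h where "h = (\<lambda>u. sgn u * \<bar>u\<bar> powr (p - 1) * std_normal_density u)"
  have [measurable]: "g \<in> borel_measurable borel" "h \<in> borel_measurable borel"
    by (simp_all add: g_def h_def)
  have g: "integrable lborel g"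
    by (rule Bochner_Integration.integrable_bound[OF integrable_exp_square_power[OF t0, of 3]])
      (auto simp: g_def abs_mult power_abs)
  have h: "integrable lborel h"
    unfolding h_def using assms by (intro integrable_sgn_abs_powr_normal) simp
  have S: "?S x = (\<integral>u. h u * sin (x * u) \<partial>lborel)" for x
    by (simp add: sgn_moment_sin_def h_def)
  \<comment> \<open>Since the sine is bounded by 1, the product of two integrable functions
    dominates; this justifies exchanging the integrals.\<close>
  have "integrable (lborel \<Otimes>\<^sub>M lborel) (\<lambda>(x, u). g x * h u * sin (x * u))"
  proof (rule Bochner_Integration.integrable_bound)
    show "integrable (lborel \<Otimes>\<^sub>M lborel) (\<lambda>(x, u). g x * h u)"
      by (rule lborel_pair.integrable_product[OF g h])
    show "AE z in lborel \<Otimes>\<^sub>M lborel. norm (case z of (x, u) \<Rightarrow> g x * h u * sin (x * u))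
        \<le> norm (case z of (x, u) \<Rightarrow> g x * h u)"
      by (intro AE_I2) (auto simp: abs_mult intro!: mult_left_le)
  qed measurable
  then have int: "integrable (lborel \<Otimes>\<^sub>M lborel) (case_prod (\<lambda>x u. g x * h u * sin (x * u)))" by simp
  have "(\<integral>x. g x * ?S x \<partial>lborel) = (\<integral>x. (\<integral>u. g x * h u * sin (x * u) \<partial>lborel) \<partial>lborel)"
    unfolding S by (simp add: mult.assoc)
  also have "\<dots> = (\<integral>u. (\<integral>x. g x * h u * sin (x * u) \<partial>lborel) \<partial>lborel)"
    by (rule lborel_pair.Fubini_integral[OF int, symmetric])
  also have "\<dots> = (\<integral>u. h u * (sqrt (2 * pi) / (t ^ 2 * sqrt t) * (3 * u - u ^ 3 / t) * exp (- u\<^sup>2 / (2 * t))) \<partial>lborel)"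
  proof (rule Bochner_Integration.integral_cong[OF refl])
    fix u
    have "(\<integral>x. g x * h u * sin (x * u) \<partial>lborel) = h u * (\<integral>x. x ^ 3 * exp (- t * x\<^sup>2 / 2) * sin (x * u) \<partial>lborel)"
      unfolding g_def by (subst integral_mult_right_zero[symmetric]) (simp add: mult_ac)
    then show "(\<integral>x. g x * h u * sin (x * u) \<partial>lborel) = h u * (sqrt (2 * pi) / (t ^ 2 * sqrt t) * (3 * u - u ^ 3 / t) * exp (- u\<^sup>2 / (2 * t)))"
      unfolding integral_sin_cubic_exp[OF t0] .
  qed
  also have "\<dots> = (\<integral>u. 1 / (t ^ 2 * sqrt t) *
      (sgn u * \<bar>u\<bar> powr (p - 1) * (3 * u - u ^ 3 / t) * exp (- (1 + 1 / t) * u\<^sup>2 / 2)) \<partial>lborel)"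
  proof (rule Bochner_Integration.integral_cong[OF refl])
    fix u
    have "exp (- (1 + 1 / t) * u\<^sup>2 / 2) = exp (- u\<^sup>2 / 2) * exp (- u\<^sup>2 / (2 * t))"
      using t0 by (simp add: field_simps flip: exp_add)
    then show "h u * (sqrt (2 * pi) / (t ^ 2 * sqrt t) * (3 * u - u ^ 3 / t) * exp (- u\<^sup>2 / (2 * t)))
        = 1 / (t ^ 2 * sqrt t) * (sgn u * \<bar>u\<bar> powr (p - 1) * (3 * u - u ^ 3 / t) * exp (- (1 + 1 / t) * u\<^sup>2 / 2))"
      by (simp add: h_def std_normal_density_def)
  qed
  also have "\<dots> = 0"
    unfolding integral_mult_right_zero integral_sgn_abs_powr_cubic_exp[OF assms t_def] by simp
  finally have zero: "(\<integral>x. g x * ?S x * ?S 1 \<partial>lborel) = 0" by simp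
  have pos: "0 < g x * ?S x * ?S 1" if "x \<noteq> 0" for x
  proof (cases "0 < x")
    case True
    then show ?thesis using same_sign[of x] by (simp add: g_def mult.assoc)
  next
    case False
    then have "x < 0" using that by simp
    then have "0 < - g x" by (simp add: g_def mult_neg_pos)
    then have "0 < - g x * (?S (- x) * ?S 1)"
      using same_sign[of "- x"] \<open>x < 0\<close> by (intro mult_pos_pos[of "- g x"]) simp_all
    then show ?thesis by (simp add: sgn_moment_sin_minus)
  qed
  have nonneg: "0 \<le> g x * ?S x * ?S 1" for x
    using pos[of x] by (cases "x = 0") (auto simp: g_def)
  have "integrable lborel (\<lambda>x. (\<integral>u. g x * h u * sin (x * u) \<partial>lborel) * ?S 1)"
    using lborel_pair.integrable_fst[OF int] by simp
  then have "integrable lborel (\<lambda>x. g x * ?S x * ?S 1)"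
    unfolding S by (simp add: mult.assoc)
  from integral_nonneg_eq_0_iff_AE[OF this] zero nonneg
  have "AE x in lborel. g x * ?S x * ?S 1 = 0" by simp
  \<comment> \<open>The integrand is strictly positive off 0, so its vanishing almost everywhere
    would leave only a single point outside a null set.\<close>
  then have "AE x in lborel. x = (0::real)" by eventually_elim (metis pos less_irrefl)
  with AE_lborel_singleton[of "0::real"] have "AE x in (lborel :: real measure). False"
    by eventually_elim simp
  then show False by (simp add: eventually_False ae_filter_eq_bot_iff)
qed

section \<open>The conditional cost\<close>

lemma integral_odd_eq_0:
  fixes f :: "real \<Rightarrow> real"
  assumes "\<And>x. f (- x) = - f x"
  shows "(\<integral>x. f x \<partial>lborel) = 0"
  using lborel_integral_real_affine[of "-1" f 0] assms by simp

text \<open>The conditional density of \<open>U\<close>, left unnormalized: its total mass depends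
  on \<open>\<psi>\<close> but not on the estimate, so it does not affect which estimate is
  best.\<close>

definition cos_weight :: "real \<Rightarrow> real \<Rightarrow> real \<Rightarrow> real \<Rightarrow> real" where
  "cos_weight \<rho> \<omega> \<psi> u = std_normal_density u * (1 + \<rho> * cos (\<omega> * u + \<psi>))"

definition cos_Lp_cost :: "real \<Rightarrow> real \<Rightarrow> real \<Rightarrow> real \<Rightarrow> real \<Rightarrow> real" where
  "cos_Lp_cost p \<rho> \<omega> \<psi> v = (\<integral>u. \<bar>u - v\<bar> powr p * cos_weight \<rho> \<omega> \<psi> u \<partial>lborel)"

lemma one_plus_cos_nonneg:
  fixes \<rho> y :: real
  assumes "\<bar>\<rho>\<bar> \<le> 1"
  shows "0 \<le> 1 + \<rho> * cos y"
proof -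
  have "\<bar>\<rho> * cos y\<bar> \<le> 1 * 1" unfolding abs_mult by (rule mult_mono) (use assms in auto)
  then show ?thesis by linarith
qed

lemma cos_weight_nonneg: "\<bar>\<rho>\<bar> \<le> 1 \<Longrightarrow> 0 \<le> cos_weight \<rho> \<omega> \<psi> u"
  by (simp add: cos_weight_def one_plus_cos_nonneg)

lemma borel_measurable_cos_weight [measurable]:
  "cos_weight \<rho> \<omega> \<psi> \<in> borel_measurable borel"
  unfolding cos_weight_def[abs_def] by measurable

lemma integrable_cos_weight:
  assumes "integrable lborel (\<lambda>u. h u * std_normal_density u)"
  shows "integrable lborel (\<lambda>u. h u * cos_weight \<rho> \<omega> \<psi> u)"
proof -
  have "\<bar>1 + \<rho> * cos y\<bar> \<le> 1 + \<bar>\<rho>\<bar>" for y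
    using abs_triangle_ineq[of 1 "\<rho> * cos y"] mult_left_mono[OF abs_cos_le_one[of y], of "\<bar>\<rho>\<bar>"]
    by (simp add: abs_mult)
  then have "integrable lborel (\<lambda>u. h u * std_normal_density u * (1 + \<rho> * cos (\<omega> * u + \<psi>)))"
    by (intro integrable_normal_bounded[OF assms]) auto
  then show ?thesis by (simp add: cos_weight_def mult.assoc)
qed

lemma integrable_abs_powr_cos_weight:
  fixes q :: real
  assumes "0 \<le> q"
  shows "integrable lborel (\<lambda>u. \<bar>u - v\<bar> powr q * cos_weight \<rho> \<omega> \<psi> u)"
  by (intro integrable_cos_weight integrable_abs_powr_diff_normal assms)

lemma integrable_sgn_abs_powr_cos_weight:
  fixes q :: real
  assumes "0 \<le> q"
  shows "integrable lborel (\<lambda>u. sgn (u - v) * \<bar>u - v\<bar> powr q * cos_weight \<rho> \<omega> \<psi> u)"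
  by (rule Bochner_Integration.integrable_bound[OF integrable_abs_powr_cos_weight[OF assms, of v \<rho> \<omega> \<psi>]])
    (auto simp: abs_mult abs_sgn_eq)

lemma integral_cos_weight: "(\<integral>u. cos_weight \<rho> \<omega> \<psi> u \<partial>lborel) = 1 + \<rho> * (exp (- \<omega>\<^sup>2 / 2) * cos \<psi>)"
proof -
  have i: "integrable lborel (\<lambda>u. std_normal_density u * cos (\<omega> * u))"
    using integrable_normal_moment_cos[of 0 \<omega> 0] by simp
  have j: "integrable lborel (\<lambda>u. std_normal_density u * sin (\<omega> * u))"
    using integrable_normal_moment_cos[of 0 \<omega> "- pi / 2"] by (simp add: cos_diff flip: diff_conv_add_uminus)
  have "(\<integral>u. cos_weight \<rho> \<omega> \<psi> u \<partial>lborel) = (\<integral>u. std_normal_density u + (\<rho> * cos \<psi> * (std_normal_density u * cos (\<omega> * u))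
      - \<rho> * sin \<psi> * (std_normal_density u * sin (\<omega> * u))) \<partial>lborel)"
    by (simp add: cos_weight_def cos_add algebra_simps)
  also have "\<dots> = 1 + (\<rho> * cos \<psi> * (\<integral>u. std_normal_density u * cos (\<omega> * u) \<partial>lborel)
      - \<rho> * sin \<psi> * (\<integral>u. std_normal_density u * sin (\<omega> * u) \<partial>lborel))"
    using i j by simp
  also have "(\<integral>u. std_normal_density u * cos (\<omega> * u) \<partial>lborel) = exp (- \<omega>\<^sup>2 / 2)"
    using normal_moment_cos_0[of \<omega>] by (simp add: normal_moment_cos_def)
  also have "(\<integral>u. std_normal_density u * sin (\<omega> * u) \<partial>lborel) = 0"
    by (rule integral_odd_eq_0) (simp add: std_normal_density_def)
  finally show ?thesis by simp
qed

text \<open>The excluded case is precisely the one where the weight is identically 0. For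
  \<open>\<omega> \<noteq> 0\<close> the factor \<open>exp (- \<omega>\<^sup>2 / 2) < 1\<close>
  keeps the mass positive even if \<open>\<bar>\<rho>\<bar> = 1\<close>.\<close>

lemma integral_cos_weight_pos:
  assumes "\<bar>\<rho>\<bar> \<le> 1" "\<not> (\<omega> = 0 \<and> \<rho> * cos \<psi> = -1)"
  shows "0 < (\<integral>u. cos_weight \<rho> \<omega> \<psi> u \<partial>lborel)"
proof (cases "\<omega> = 0")
  case True
  then show ?thesis
    using assms one_plus_cos_nonneg[OF assms(1), of \<psi>] unfolding integral_cos_weight by simp
next
  case False
  define e where "e = exp (- \<omega>\<^sup>2 / 2)"
  have "\<bar>\<rho> * cos \<psi>\<bar> \<le> 1 * 1" unfolding abs_mult by (rule mult_mono) (use assms in auto)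
  moreover have "0 < e" "e < 1" using False by (auto simp: e_def)
  ultimately have "\<bar>e * (\<rho> * cos \<psi>)\<bar> \<le> e * 1"
    unfolding abs_mult by (intro mult_mono) auto
  then have "-1 < e * (\<rho> * cos \<psi>)" using \<open>e < 1\<close> by linarith
  then show ?thesis unfolding integral_cos_weight e_def by (simp add: mult_ac)
qed

text \<open>The weight may vanish at some points, but a zero integral would make it vanish almost
  everywhere, contradicting its positive mass.\<close>

lemma integral_cos_weight_strict:
  assumes "\<bar>\<rho>\<bar> \<le> 1" "\<not> (\<omega> = 0 \<and> \<rho> * cos \<psi> = -1)"
    and "integrable lborel (\<lambda>u. h u * cos_weight \<rho> \<omega> \<psi> u)" "\<And>u. 0 < h u"
  shows "0 < (\<integral>u. h u * cos_weight \<rho> \<omega> \<psi> u \<partial>lborel)"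
proof -
  have nn: "0 \<le> h u * cos_weight \<rho> \<omega> \<psi> u" for u
    using assms(1,4) by (simp add: cos_weight_nonneg less_imp_le)
  have "(\<integral>u. h u * cos_weight \<rho> \<omega> \<psi> u \<partial>lborel) \<noteq> 0"
  proof
    assume "(\<integral>u. h u * cos_weight \<rho> \<omega> \<psi> u \<partial>lborel) = 0"
    then have "AE u in lborel. h u * cos_weight \<rho> \<omega> \<psi> u = 0"
      using integral_nonneg_eq_0_iff_AE[OF assms(3)] nn by simp
    then have "AE u in lborel. cos_weight \<rho> \<omega> \<psi> u = 0"
      by eventually_elim (use assms(4) in \<open>metis less_irrefl mult_eq_0_iff\<close>)
    then have "(\<integral>u. cos_weight \<rho> \<omega> \<psi> u \<partial>lborel) = 0"
      by (rule integral_eq_zero_AE)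
    then show False using integral_cos_weight_pos[OF assms(1,2)] by simp
  qed
  moreover have "0 \<le> (\<integral>u. h u * cos_weight \<rho> \<omega> \<psi> u \<partial>lborel)"
    by (intro Bochner_Integration.integral_nonneg nn)
  ultimately show ?thesis by simp
qed

text \<open>After expanding the cosine of the sum, the terms with the signed power alone and with
  \<open>cos (\<omega> * u)\<close> are odd and integrate to 0; only the sine term survives. For
  \<open>q = p - 1\<close>, multiplying by \<open>- p\<close> gives the slope of the conditional
  cost at 0.\<close>

lemma integral_sgn_abs_powr_cos_weight:
  fixes q :: real
  assumes "0 \<le> q"
  shows "(\<integral>u. sgn u * \<bar>u\<bar> powr q * cos_weight \<rho> \<omega> \<psi> u \<partial>lborel) = - \<rho> * sin \<psi> * sgn_moment_sin q \<omega>"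
proof -
  define h where "h = (\<lambda>u. sgn u * \<bar>u\<bar> powr q * std_normal_density u)"
  have h: "integrable lborel h"
    unfolding h_def by (rule integrable_sgn_abs_powr_normal[OF assms])
  have i: "integrable lborel (\<lambda>u. h u * cos (\<omega> * u))" "integrable lborel (\<lambda>u. h u * sin (\<omega> * u))"
    using h unfolding h_def by (intro integrable_normal_bounded[where B=1]; simp)+
  have "(\<integral>u. sgn u * \<bar>u\<bar> powr q * cos_weight \<rho> \<omega> \<psi> u \<partial>lborel)
      = (\<integral>u. h u + (\<rho> * cos \<psi> * (h u * cos (\<omega> * u)) - \<rho> * sin \<psi> * (h u * sin (\<omega> * u))) \<partial>lborel)"
    by (simp add: cos_weight_def h_def cos_add algebra_simps)
  also have "\<dots> = (\<integral>u. h u \<partial>lborel) + (\<rho> * cos \<psi> * (\<integral>u. h u * cos (\<omega> * u) \<partial>lborel)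
      - \<rho> * sin \<psi> * (\<integral>u. h u * sin (\<omega> * u) \<partial>lborel))"
    using i h by simp
  also have "(\<integral>u. h u \<partial>lborel) = 0"
    by (rule integral_odd_eq_0) (simp add: h_def std_normal_density_def sgn_minus)
  also have "(\<integral>u. h u * cos (\<omega> * u) \<partial>lborel) = 0"
    by (rule integral_odd_eq_0) (simp add: h_def std_normal_density_def sgn_minus)
  finally show ?thesis by (simp add: sgn_moment_sin_def h_def)
qed

section \<open>Strict convexity and minimality of the conditional cost\<close>

lemma cos_Lp_cost_nonneg: "\<bar>\<rho>\<bar> \<le> 1 \<Longrightarrow> 0 \<le> cos_Lp_cost p \<rho> \<omega> \<psi> v"
  unfolding cos_Lp_cost_def by (intro Bochner_Integration.integral_nonneg) (simp add: cos_weight_nonneg)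

text \<open>The pointwise tangent inequality integrated against the weight. The integral times
  \<open>- p\<close> acts as the slope at \<open>w\<close>, so strict convexity is available without
  differentiating the cost.\<close>

lemma cos_Lp_cost_above_tangent:
  assumes "\<bar>\<rho>\<bar> \<le> 1" "\<not> (\<omega> = 0 \<and> \<rho> * cos \<psi> = -1)" "1 < p" "v \<noteq> w"
  shows "cos_Lp_cost p \<rho> \<omega> \<psi> w + p * (w - v) *
      (\<integral>u. sgn (u - w) * \<bar>u - w\<bar> powr (p - 1) * cos_weight \<rho> \<omega> \<psi> u \<partial>lborel) < cos_Lp_cost p \<rho> \<omega> \<psi> v"
proof -
  let ?W = "cos_weight \<rho> \<omega> \<psi>"
  let ?h = "\<lambda>u. \<bar>u - v\<bar> powr p - (\<bar>u - w\<bar> powr p + p * (w - v) * (sgn (u - w) * \<bar>u - w\<bar> powr (p - 1)))"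
  have i: "integrable lborel (\<lambda>u. \<bar>u - x\<bar> powr p * ?W u)" for x
    using assms by (intro integrable_abs_powr_cos_weight) simp
  have j: "integrable lborel (\<lambda>u. sgn (u - w) * \<bar>u - w\<bar> powr (p - 1) * ?W u)"
    using assms by (intro integrable_sgn_abs_powr_cos_weight) simp
  have eq: "(\<lambda>u. ?h u * ?W u) = (\<lambda>u. \<bar>u - v\<bar> powr p * ?W u - (\<bar>u - w\<bar> powr p * ?W u
      + p * (w - v) * (sgn (u - w) * \<bar>u - w\<bar> powr (p - 1) * ?W u)))"
    by (simp add: algebra_simps)
  have int: "integrable lborel (\<lambda>u. ?h u * ?W u)"
    unfolding eq using i j by (intro Bochner_Integration.integrable_diff Bochner_Integration.integrable_add integrable_mult_right)
  have "0 < (\<integral>u. ?h u * ?W u \<partial>lborel)"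
  proof (rule integral_cos_weight_strict[OF assms(1,2) int])
    fix u
    have "(u - v) - (u - w) = w - v" by simp
    then show "0 < ?h u"
      using abs_powr_above_tangent[OF assms(3), of "u - v" "u - w"] assms(4) by simp
  qed
  also have "\<dots> = cos_Lp_cost p \<rho> \<omega> \<psi> v - (cos_Lp_cost p \<rho> \<omega> \<psi> w
      + p * (w - v) * (\<integral>u. sgn (u - w) * \<bar>u - w\<bar> powr (p - 1) * ?W u \<partial>lborel))"
    unfolding eq cos_Lp_cost_def using i j by simp
  finally show ?thesis by simp
qed

lemma cos_Lp_cost_min_0:
  assumes "\<bar>\<rho>\<bar> \<le> 1" "\<not> (\<omega> = 0 \<and> \<rho> * cos \<psi> = -1)" "1 < p"
    and "\<rho> * sgn_moment_sin (p - 1) \<omega> = 0" "v \<noteq> 0"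
  shows "cos_Lp_cost p \<rho> \<omega> \<psi> 0 < cos_Lp_cost p \<rho> \<omega> \<psi> v"
proof -
  have "(\<integral>u. sgn u * \<bar>u\<bar> powr (p - 1) * cos_weight \<rho> \<omega> \<psi> u \<partial>lborel) = 0"
    using integral_sgn_abs_powr_cos_weight[of "p - 1" \<rho> \<omega> \<psi>] assms(3,4) by auto
  then show ?thesis using cos_Lp_cost_above_tangent[OF assms(1-3), of v 0] assms(5) by simp
qed

text \<open>Adding the tangent inequalities at \<open>v\<close> for the displacements
  \<open>d\<close> and \<open>- d\<close> cancels the linear terms.\<close>

lemma cos_Lp_cost_midpoint:
  assumes "\<bar>\<rho>\<bar> \<le> 1" "\<not> (\<omega> = 0 \<and> \<rho> * cos \<psi> = -1)" "1 < p" "d \<noteq> 0"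
  shows "2 * cos_Lp_cost p \<rho> \<omega> \<psi> v < cos_Lp_cost p \<rho> \<omega> \<psi> (v - d) + cos_Lp_cost p \<rho> \<omega> \<psi> (v + d)"
  using cos_Lp_cost_above_tangent[OF assms(1-3), of "v - d" v]
    cos_Lp_cost_above_tangent[OF assms(1-3), of "v + d" v] assms(4)
  by simp

lemma tendsto_integral_sgn_abs_powr:
  fixes q :: real and X :: "nat \<Rightarrow> real"
  assumes "1 < q" "X \<longlonglongrightarrow> 0" "\<And>n. \<bar>X n\<bar> \<le> 1"
  shows "(\<lambda>n. \<integral>u. sgn (u - X n) * \<bar>u - X n\<bar> powr q * cos_weight \<rho> \<omega> \<psi> u \<partial>lborel)
    \<longlonglongrightarrow> (\<integral>u. sgn u * \<bar>u\<bar> powr q * cos_weight \<rho> \<omega> \<psi> u \<partial>lborel)"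
proof (rule integral_dominated_convergence)
  let ?W = "cos_weight \<rho> \<omega> \<psi>"
  \<comment> \<open>The term \<open>\<bar>u\<bar> powr 0\<close> stands for the constant 1, except
    that \<open>0 powr 0 = 0\<close>; this is why the domination below discards the point 0.\<close>
  show "integrable lborel (\<lambda>u. 2 powr q * (\<bar>\<bar>u\<bar> powr q * ?W u\<bar> + \<bar>\<bar>u\<bar> powr 0 * ?W u\<bar>))"
    using integrable_abs_powr_cos_weight[of q 0 \<rho> \<omega> \<psi>] integrable_cos_weight[of "\<lambda>u. \<bar>u\<bar> powr 0" \<rho> \<omega> \<psi>]
      integrable_abs_powr_normal[of 0] assms(1)
    by (intro integrable_mult_right Bochner_Integration.integrable_add integrable_abs) simp_all
  show "AE u in lborel. (\<lambda>n. sgn (u - X n) * \<bar>u - X n\<bar> powr q * ?W u) \<longlonglongrightarrow> sgn u * \<bar>u\<bar> powr q * ?W u"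
  proof (intro AE_I2 tendsto_mult_right)
    fix u
    have "(\<lambda>n. u - X n) \<longlonglongrightarrow> u - 0" by (intro tendsto_diff tendsto_const assms(2))
    then show "(\<lambda>n. sgn (u - X n) * \<bar>u - X n\<bar> powr q) \<longlonglongrightarrow> sgn u * \<bar>u\<bar> powr q"
      using isCont_tendsto_compose[OF DERIV_isCont[OF DERIV_sgn_abs_powr[OF assms(1), of u]]] by simp
  qed
  show "AE u in lborel. norm (sgn (u - X n) * \<bar>u - X n\<bar> powr q * ?W u)
      \<le> 2 powr q * (\<bar>\<bar>u\<bar> powr q * ?W u\<bar> + \<bar>\<bar>u\<bar> powr 0 * ?W u\<bar>)" for n
  proof (rule AE_mp[OF AE_lborel_singleton[of 0]], intro AE_I2 impI)
    fix u :: real assume "u \<noteq> 0"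
    have "\<bar>X n\<bar> powr q \<le> 1" using assms by (intro powr_le1) auto
    then have "2 powr q * (\<bar>u\<bar> powr q + \<bar>X n\<bar> powr q) \<le> 2 powr q * (\<bar>u\<bar> powr q + 1)" by simp
    with abs_powr_diff_le[of q u "X n"] assms(1)
    have "\<bar>u - X n\<bar> powr q \<le> 2 powr q * (\<bar>u\<bar> powr q + 1)" by linarith
    moreover have "\<bar>sgn (u - X n)\<bar> \<le> 1" by (simp add: abs_sgn_eq)
    ultimately have "\<bar>sgn (u - X n)\<bar> * \<bar>u - X n\<bar> powr q \<le> 1 * (2 powr q * (\<bar>u\<bar> powr q + 1))"
      by (intro mult_mono) auto
    from mult_right_mono[OF this abs_ge_zero[of "?W u"]] \<open>u \<noteq> 0\<close>
    show "norm (sgn (u - X n) * \<bar>u - X n\<bar> powr q * ?W u) \<le> 2 powr q * (\<bar>\<bar>u\<bar> powr q * ?W u\<bar> + \<bar>\<bar>u\<bar> powr 0 * ?W u\<bar>)"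
      by (simp add: abs_mult algebra_simps)
  qed
qed auto

text \<open>First-order condition from countably many test points, so that it can later be applied
  outside a single null set. Each tangent at a test point fixes the sign of the slope there, and the
  limits from both sides squeeze the slope at 0.\<close>

lemma cos_Lp_cost_min_0_imp:
  assumes "\<bar>\<rho>\<bar> \<le> 1" "\<not> (\<omega> = 0 \<and> \<rho> * cos \<psi> = -1)" "2 < p"
    and min: "\<And>n. cos_Lp_cost p \<rho> \<omega> \<psi> 0 \<le> cos_Lp_cost p \<rho> \<omega> \<psi> (1 / real (Suc n))"
      "\<And>n. cos_Lp_cost p \<rho> \<omega> \<psi> 0 \<le> cos_Lp_cost p \<rho> \<omega> \<psi> (- 1 / real (Suc n))"
  shows "\<rho> * sin \<psi> * sgn_moment_sin (p - 1) \<omega> = 0"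
proof -
  let ?D = "\<lambda>v. \<integral>u. sgn (u - v) * \<bar>u - v\<bar> powr (p - 1) * cos_weight \<rho> \<omega> \<psi> u \<partial>lborel"
  \<comment> \<open>The tangent at \<open>v\<close> lies strictly below the cost at 0, which is at
    most the cost at \<open>v\<close>.\<close>
  have D: "v * ?D v < 0" if "v \<noteq> 0" "cos_Lp_cost p \<rho> \<omega> \<psi> 0 \<le> cos_Lp_cost p \<rho> \<omega> \<psi> v" for v
  proof -
    have "p * (v * ?D v) < 0"
      using cos_Lp_cost_above_tangent[OF assms(1,2), of p 0 v] that assms(3) by simp
    then show ?thesis using assms(3) by (simp add: mult_less_0_iff)
  qed
  have lim: "(\<lambda>n. ?D (s / real (Suc n))) \<longlonglongrightarrow> ?D 0" if "\<bar>s\<bar> = 1" for s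
  proof -
    have "(\<lambda>n. s / real (Suc n)) \<longlonglongrightarrow> 0" by (rule LIMSEQ_Suc[OF lim_const_over_n])
    moreover have "\<bar>s / real (Suc n)\<bar> \<le> 1" for n using that by simp
    ultimately show ?thesis using assms(3) tendsto_integral_sgn_abs_powr[of "p - 1"] by simp
  qed
  have "?D 0 \<le> 0"
  proof (rule LIMSEQ_le_const2[OF lim[of 1]])
    have "?D (1 / real (Suc n)) \<le> 0" for n
      using D[OF _ min(1)[of n]] by (simp add: mult_less_0_iff divide_less_0_iff)
    then show "\<exists>N. \<forall>n\<ge>N. ?D (1 / real (Suc n)) \<le> 0" by blast
  qed simp
  moreover have "0 \<le> ?D 0"
  proof (rule LIMSEQ_le_const[OF lim[of "-1"]])
    have "0 \<le> ?D (- 1 / real (Suc n))" for n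
      using D[OF _ min(2)[of n]] by (simp add: zero_less_divide_iff)
    then show "\<exists>N. \<forall>n\<ge>N. 0 \<le> ?D (- 1 / real (Suc n))" by blast
  qed simp
  ultimately show ?thesis
    using integral_sgn_abs_powr_cos_weight[of "p - 1" \<rho> \<omega> \<psi>] assms(3) by auto
qed

section \<open>The Gaussian noise model\<close>

text \<open>Rescaling by the standard deviation of the Gaussian factor makes the prior itself a
  \<open>cos_weight\<close>, so its integrability and positive mass follow from those of the
  weight.\<close>

lemma cos_perturbed_gaussian_affine:
  assumes "0 < a" "a < 1"
  shows "cos_perturbed_gaussian a \<rho> \<theta> \<omega> (1 / sqrt ((1 - a) / a) * v)
    = sqrt (2 * pi) * cos_weight \<rho> (\<omega> / sqrt (1 - a)) \<theta> v"
proof -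
  have "sqrt ((1 - a) / a) * sqrt a = sqrt (1 - a)" using assms by (simp flip: real_sqrt_mult)
  then have 1: "\<omega> * (1 / sqrt ((1 - a) / a) * v) / sqrt a = \<omega> / sqrt (1 - a) * v" by simp
  have "- t * ((1 / sqrt t * v)\<^sup>2 / 2) = - v\<^sup>2 / 2" if "0 < t" for t
    using that by (simp add: power_divide)
  from this[of "(1 - a) / a"]
  have 2: "- ((1 - a) / a) * ((1 / sqrt ((1 - a) / a) * v)\<^sup>2 / 2) = - v\<^sup>2 / 2"
    using assms by simp
  show ?thesis
    unfolding cos_perturbed_gaussian_def cos_weight_def 1 2 by (simp add: std_normal_density_def)
qed

lemma integrable_cos_perturbed_gaussian:
  assumes "0 < a" "a < 1"
  shows "integrable lborel (cos_perturbed_gaussian a \<rho> \<theta> \<omega>)"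
proof -
  have "integrable lborel (\<lambda>v. sqrt (2 * pi) * cos_weight \<rho> (\<omega> / sqrt (1 - a)) \<theta> v)"
    using integrable_cos_weight[of "\<lambda>_. 1"] by simp
  then have "integrable lborel (\<lambda>v. cos_perturbed_gaussian a \<rho> \<theta> \<omega> (0 + 1 / sqrt ((1 - a) / a) * v))"
    using cos_perturbed_gaussian_affine[OF assms] by simp
  then show ?thesis
    by (subst (asm) lborel_integrable_real_affine_iff) (use assms in auto)
qed

lemma integral_cos_perturbed_gaussian_pos:
  assumes "0 < a" "a < 1" "\<bar>\<rho>\<bar> \<le> 1" "\<not> (\<omega> = 0 \<and> \<rho> * cos \<theta> = -1)"
  shows "0 < (\<integral>x. cos_perturbed_gaussian a \<rho> \<theta> \<omega> x \<partial>lborel)"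
proof -
  have c: "0 < 1 / sqrt ((1 - a) / a)" using assms by simp
  have "(\<integral>x. cos_perturbed_gaussian a \<rho> \<theta> \<omega> x \<partial>lborel)
      = \<bar>1 / sqrt ((1 - a) / a)\<bar> *\<^sub>R (\<integral>v. cos_perturbed_gaussian a \<rho> \<theta> \<omega> (0 + 1 / sqrt ((1 - a) / a) * v) \<partial>lborel)"
    by (rule lborel_integral_real_affine) (use assms in auto)
  also have "\<dots> = 1 / sqrt ((1 - a) / a) * (sqrt (2 * pi) * (\<integral>v. cos_weight \<rho> (\<omega> / sqrt (1 - a)) \<theta> v \<partial>lborel))"
    unfolding add_0 cos_perturbed_gaussian_affine[OF assms(1,2)] using c by simp
  also have "\<dots> > 0"
    using assms by (intro mult_pos_pos c integral_cos_weight_pos) auto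
  finally show ?thesis .
qed

lemma borel_measurable_cos_perturbed_gaussian [measurable]:
  "cos_perturbed_gaussian a \<rho> \<theta> \<omega> \<in> borel_measurable borel"
  unfolding cos_perturbed_gaussian_def[abs_def] by measurable

lemma prob_density_cos_perturbed_gaussian:
  assumes "0 < a" "a < 1" "\<bar>\<rho>\<bar> \<le> 1" "\<not> (\<omega> = 0 \<and> \<rho> * cos \<theta> = -1)"
  shows "prob_density (normalized (cos_perturbed_gaussian a \<rho> \<theta> \<omega>))"
  unfolding prob_density_def
proof (intro conjI allI)
  let ?q = "cos_perturbed_gaussian a \<rho> \<theta> \<omega>"
  note pos = integral_cos_perturbed_gaussian_pos[OF assms]
  show "normalized ?q \<in> borel_measurable borel" unfolding normalized_def[abs_def] by measurable
  show nn: "0 \<le> normalized ?q x" for x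
    using pos one_plus_cos_nonneg[OF assms(3)]
    by (simp add: normalized_def cos_perturbed_gaussian_def)
  have "integrable lborel (normalized ?q)"
    unfolding normalized_def[abs_def] using integrable_cos_perturbed_gaussian[OF assms(1,2)] by simp
  then have "(\<integral>\<^sup>+x. ennreal (normalized ?q x) \<partial>lborel) = ennreal (\<integral>x. normalized ?q x \<partial>lborel)"
    using nn by (intro nn_integral_eq_integral) auto
  also have "(\<integral>x. normalized ?q x \<partial>lborel) = 1"
    unfolding normalized_def using pos by simp
  finally have "(\<integral>\<^sup>+x. ennreal (normalized ?q x) \<partial>lborel) = 1" by simp
  then show "prob_space (density lborel (\<lambda>x. ennreal (normalized ?q x)))"
    by (intro prob_spaceI) (simp add: emeasure_density normalized_def[abs_def])
qed

text \<open>Independence gives a product density for \<open>X\<close> and \<open>Z\<close>; the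
  shift \<open>z = y - x\<close> turns it into the joint density of \<open>X\<close> and
  \<open>Y\<close>, and Tonelli puts \<open>y\<close> outside so that the inner integral is
  conditional.\<close>

lemma nn_integral_gaussian_noise_model:
  assumes "gaussian_noise_model f M X Z" and [measurable]: "f \<in> borel_measurable borel"
    and [measurable]: "h \<in> borel_measurable (borel \<Otimes>\<^sub>M borel)"
  shows "(\<integral>\<^sup>+w. h (X w, X w + Z w) \<partial>M)
    = (\<integral>\<^sup>+y. (\<integral>\<^sup>+x. ennreal (f x) * ennreal (std_normal_density (y - x)) * h (x, y) \<partial>lborel) \<partial>lborel)"
proof -
  have X: "distributed M lborel X (\<lambda>x. ennreal (f x))"
    and Z: "distributed M lborel Z (\<lambda>z. ennreal (std_normal_density z))"
    and M: "prob_space M" and ind: "prob_space.indep_var M borel X borel Z"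
    using assms(1) by (auto simp: gaussian_noise_model_def)
  interpret prob_space M by fact
  \<comment> \<open>Independence is phrased with \<open>borel\<close> and the densities with
    \<open>lborel\<close>; the two have the same measurable sets, so the distributions
    agree.\<close>
  have "distr M lborel X \<Otimes>\<^sub>M distr M lborel Z = distr M borel X \<Otimes>\<^sub>M distr M borel Z"
    by (intro arg_cong2[where f=pair_measure] distr_cong) auto
  also have "\<dots> = distr M (borel \<Otimes>\<^sub>M borel) (\<lambda>w. (X w, Z w))"
    using ind unfolding indep_var_distribution_eq by blast
  also have "\<dots> = distr M (lborel \<Otimes>\<^sub>M lborel) (\<lambda>w. (X w, Z w))"
    by (intro distr_cong sets_pair_measure_cong) auto
  finally have J: "distributed M (lborel \<Otimes>\<^sub>M lborel) (\<lambda>w. (X w, Z w))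
      (\<lambda>(x, z). ennreal (f x) * ennreal (std_normal_density z))"
    by (intro distributed_joint_indep'[OF _ _ X Z]) (auto intro: lborel.sigma_finite_measure_axioms)
  have "(\<integral>\<^sup>+w. h (X w, X w + Z w) \<partial>M)
      = (\<integral>\<^sup>+v. (case v of (x, z) \<Rightarrow> ennreal (f x) * ennreal (std_normal_density z)) * (case v of (x, z) \<Rightarrow> h (x, x + z)) \<partial>(lborel \<Otimes>\<^sub>M lborel))"
    by (subst distributed_nn_integral[OF J]) auto
  also have "\<dots> = (\<integral>\<^sup>+x. (\<integral>\<^sup>+z. ennreal (f x) * ennreal (std_normal_density z) * h (x, x + z) \<partial>lborel) \<partial>lborel)"
    by (subst lborel.nn_integral_fst[symmetric]) auto
  also have "\<dots> = (\<integral>\<^sup>+x. (\<integral>\<^sup>+y. ennreal (f x) * ennreal (std_normal_density (y - x)) * h (x, y) \<partial>lborel) \<partial>lborel)"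
  proof (rule nn_integral_cong)
    fix x
    show "(\<integral>\<^sup>+z. ennreal (f x) * ennreal (std_normal_density z) * h (x, x + z) \<partial>lborel)
        = (\<integral>\<^sup>+y. ennreal (f x) * ennreal (std_normal_density (y - x)) * h (x, y) \<partial>lborel)"
      by (subst nn_integral_real_affine[where c=1 and t="- x"]) auto
  qed
  also have "\<dots> = (\<integral>\<^sup>+y. (\<integral>\<^sup>+x. ennreal (f x) * ennreal (std_normal_density (y - x)) * h (x, y) \<partial>lborel) \<partial>lborel)"
    by (rule lborel_pair.Fubini') measurable
  finally show ?thesis .
qed

lemma not_AE_lborel_False: "\<not> (AE x in (lborel :: real measure). False)"
  by (simp add: eventually_False ae_filter_eq_bot_iff)

lemma AE_lborel_translate:
  fixes t :: real
  assumes "AE y in lborel. P y"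
  shows "AE y in lborel. P (y + t)"
proof -
  obtain N where N: "N \<in> null_sets lborel" and sub: "{y. \<not> P y} \<subseteq> N"
    using assms by (auto simp: eventually_ae_filter)
  have [measurable]: "N \<in> sets borel" using null_setsD2[OF N] by simp
  have "AE y in lborel. t + 1 * y \<notin> N"
    by (rule AE_borel_affine) (use AE_not_in[OF N] in auto)
  then show ?thesis by eventually_elim (use sub in \<open>auto simp: add.commute\<close>)
qed

section \<open>Reduction of the global cost to pointwise minimization in a fixed model\<close>

locale cos_perturbed_model =
  fixes a \<rho> \<theta> \<omega> p :: real and M :: "'w measure" and X Z :: "'w \<Rightarrow> real"
  assumes a: "0 < a" "a < 1" and rho: "\<bar>\<rho>\<bar> \<le> 1"
    and nondegenerate: "\<not> (\<omega> = 0 \<and> \<rho> * cos \<theta> = -1)"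
    and p: "2 < p"
    and model: "gaussian_noise_model (normalized (cos_perturbed_gaussian a \<rho> \<theta> \<omega>)) M X Z"
begin

definition "phase y = \<omega> * sqrt a * y + \<theta>"

text \<open>What remains of the joint density at \<open>y\<close> after completing the square,
  including the normalizing constant and the Jacobian \<open>sqrt a\<close>. Multiplied by the mass
  of \<open>cos_weight\<close>, it is the density of \<open>Y\<close>.\<close>

definition "gauss_factor y = sqrt a / (\<integral>x. cos_perturbed_gaussian a \<rho> \<theta> \<omega> x \<partial>lborel) * exp (- (1 - a) * y\<^sup>2 / 2)"

text \<open>The estimate \<open>v\<close> of \<open>X\<close> is moved to the coordinate
  \<open>U\<close>, where \<open>a * y\<close> becomes 0.\<close>

definition "local_cost y v = cos_Lp_cost p \<rho> \<omega> (phase y) ((v - a * y) / sqrt a)"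

abbreviation "cost \<equiv> Lp_cost p M X (\<lambda>w. X w + Z w)"

lemma nondegenerate_phase: "\<not> (\<omega> = 0 \<and> \<rho> * cos (phase y) = -1)"
  using nondegenerate by (auto simp: phase_def)

lemma gauss_factor_pos: "0 < gauss_factor y"
  using integral_cos_perturbed_gaussian_pos[OF a rho nondegenerate] a by (simp add: gauss_factor_def)

lemma gauss_factor_measurable [measurable]: "gauss_factor \<in> borel_measurable borel"
  unfolding gauss_factor_def[abs_def] by measurable

text \<open>Completing the square: given \<open>Y = y\<close>, the variable \<open>U = (X - a * y) / sqrt a\<close> has density
  proportional to \<open>cos_weight \<rho> \<omega> (phase y)\<close>.\<close>
lemma joint_density:
  "sqrt a * (normalized (cos_perturbed_gaussian a \<rho> \<theta> \<omega>) (a * y + sqrt a * u)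
      * std_normal_density (y - (a * y + sqrt a * u)))
    = gauss_factor y * cos_weight \<rho> \<omega> (phase y) u"
proof -
  define s where "s = sqrt a"
  have s: "0 < s" "a = s\<^sup>2" using a by (auto simp: s_def)
  have 1: "\<omega> * (a * y + s * u) / s + \<theta> = \<omega> * u + phase y"
  proof -
    have "(a * y + s * u) / s = s * y + u" using s by (simp add: field_simps power2_eq_square)
    then show ?thesis
      unfolding phase_def s_def[symmetric] times_divide_eq_right[symmetric] by (simp add: algebra_simps)
  qed
  have "- ((1 - a) / a) * ((a * y + s * u)\<^sup>2 / 2) + - (y - (a * y + s * u))\<^sup>2 / 2 = - (1 - a) * y\<^sup>2 / 2 + - u\<^sup>2 / 2"
    unfolding s(2) using s(1) by (simp add: field_simps power2_eq_square)
  then have 2: "exp (- ((1 - a) / a) * ((a * y + s * u)\<^sup>2 / 2)) * exp (- (y - (a * y + s * u))\<^sup>2 / 2)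
      = exp (- (1 - a) * y\<^sup>2 / 2) * exp (- u\<^sup>2 / 2)"
    by (simp only: exp_add[symmetric])
  show ?thesis
    unfolding s_def[symmetric] normalized_def cos_perturbed_gaussian_def[of a \<rho> \<theta> \<omega> "a * y + s * u"]
      std_normal_density_def gauss_factor_def cos_weight_def 1
    using 2 by (simp add: field_simps)
qed

lemma nn_integral_model:
  assumes [measurable]: "h \<in> borel_measurable (borel \<Otimes>\<^sub>M borel)"
  shows "(\<integral>\<^sup>+w. h (X w, X w + Z w) \<partial>M)
    = (\<integral>\<^sup>+y. (\<integral>\<^sup>+u. ennreal (gauss_factor y * cos_weight \<rho> \<omega> (phase y) u) * h (a * y + sqrt a * u, y) \<partial>lborel) \<partial>lborel)"
proof -
  let ?q = "normalized (cos_perturbed_gaussian a \<rho> \<theta> \<omega>)"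
  have q: "prob_density ?q" by (rule prob_density_cos_perturbed_gaussian[OF a rho nondegenerate])
  then have [measurable]: "?q \<in> borel_measurable borel" and qn: "0 \<le> ?q x" for x
    by (auto simp: prob_density_def)
  have s: "0 < sqrt a" using a by simp
  have "(\<integral>\<^sup>+x. ennreal (?q x) * ennreal (std_normal_density (y - x)) * h (x, y) \<partial>lborel)
      = (\<integral>\<^sup>+u. ennreal (gauss_factor y * cos_weight \<rho> \<omega> (phase y) u) * h (a * y + sqrt a * u, y) \<partial>lborel)" for y
  proof -
    have "(\<integral>\<^sup>+x. ennreal (?q x) * ennreal (std_normal_density (y - x)) * h (x, y) \<partial>lborel)
      = ennreal (sqrt a) * (\<integral>\<^sup>+u. ennreal (?q (a * y + sqrt a * u)) * ennreal (std_normal_density (y - (a * y + sqrt a * u)))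
          * h (a * y + sqrt a * u, y) \<partial>lborel)"
      using s by (subst nn_integral_real_affine[where c="sqrt a" and t="a * y"]) auto
    also have "\<dots> = (\<integral>\<^sup>+u. ennreal (sqrt a) * (ennreal (?q (a * y + sqrt a * u)) * ennreal (std_normal_density (y - (a * y + sqrt a * u)))
          * h (a * y + sqrt a * u, y)) \<partial>lborel)"
      by (rule nn_integral_cmult[symmetric]) measurable
    also have "\<dots> = (\<integral>\<^sup>+u. ennreal (gauss_factor y * cos_weight \<rho> \<omega> (phase y) u) * h (a * y + sqrt a * u, y) \<partial>lborel)"
      unfolding joint_density[symmetric] using s qn
      by (intro nn_integral_cong) (simp add: ennreal_mult mult.assoc)
    finally show ?thesis .
  qed
  then show ?thesis
    by (subst nn_integral_gaussian_noise_model[OF model]) auto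
qed

lemma local_cost_nonneg: "0 \<le> local_cost y v"
  unfolding local_cost_def by (rule cos_Lp_cost_nonneg[OF rho])

lemma local_cost_measurable [measurable]:
  assumes [measurable]: "f \<in> borel_measurable borel"
  shows "(\<lambda>y. local_cost y (f y)) \<in> borel_measurable borel"
  unfolding local_cost_def cos_Lp_cost_def cos_weight_def phase_def
  by (rule lborel.borel_measurable_lebesgue_integral) measurable

text \<open>In the coordinate \<open>U\<close> the error is \<open>sqrt a\<close> times the distance
  to the rescaled estimate, whence the factor \<open>a powr (p / 2)\<close>. The cost is thus a
  positively weighted integral of local costs, to be minimized for each \<open>y\<close>
  separately.\<close>

lemma cost_eq:
  assumes [measurable]: "f \<in> borel_measurable borel"
  shows "cost f = (\<integral>\<^sup>+y. ennreal (a powr (p / 2) * gauss_factor y * local_cost y (f y)) \<partial>lborel)"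
proof -
  have "cost f = (\<integral>\<^sup>+w. (\<lambda>(x, y). ennreal (\<bar>x - f y\<bar> powr p)) (X w, X w + Z w) \<partial>M)"
    by (simp add: Lp_cost_def)
  also have "\<dots> = (\<integral>\<^sup>+y. (\<integral>\<^sup>+u. ennreal (gauss_factor y * cos_weight \<rho> \<omega> (phase y) u)
      * ennreal (\<bar>a * y + sqrt a * u - f y\<bar> powr p) \<partial>lborel) \<partial>lborel)"
    by (subst nn_integral_model) auto
  also have "\<dots> = (\<integral>\<^sup>+y. ennreal (a powr (p / 2) * gauss_factor y * local_cost y (f y)) \<partial>lborel)"
  proof (rule nn_integral_cong)
    fix y
    let ?v = "(f y - a * y) / sqrt a"
    let ?g = "\<lambda>u. a powr (p / 2) * gauss_factor y * (\<bar>u - ?v\<bar> powr p * cos_weight \<rho> \<omega> (phase y) u)"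
    have "(\<integral>\<^sup>+u. ennreal (gauss_factor y * cos_weight \<rho> \<omega> (phase y) u) * ennreal (\<bar>a * y + sqrt a * u - f y\<bar> powr p) \<partial>lborel)
        = (\<integral>\<^sup>+u. ennreal (?g u) \<partial>lborel)"
    proof (rule nn_integral_cong)
      fix u
      have "\<bar>a * y + sqrt a * u - f y\<bar> = sqrt a * \<bar>u - ?v\<bar>"
        using a by (simp add: abs_mult_pos[symmetric] field_simps)
      moreover have "sqrt a powr p = a powr (p / 2)"
        using a by (simp add: powr_half_sqrt[symmetric] powr_powr)
      ultimately have "\<bar>a * y + sqrt a * u - f y\<bar> powr p = a powr (p / 2) * \<bar>u - ?v\<bar> powr p"
        by (simp add: powr_mult)
      then show "ennreal (gauss_factor y * cos_weight \<rho> \<omega> (phase y) u) * ennreal (\<bar>a * y + sqrt a * u - f y\<bar> powr p) = ennreal (?g u)"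
        using gauss_factor_pos[of y] cos_weight_nonneg[OF rho]
        by (simp add: mult_ac flip: ennreal_mult)
    qed
    also have "\<dots> = ennreal (\<integral>u. ?g u \<partial>lborel)"
      using p gauss_factor_pos[of y] cos_weight_nonneg[OF rho]
      by (intro nn_integral_eq_integral integrable_mult_right integrable_abs_powr_cos_weight) auto
    also have "(\<integral>u. ?g u \<partial>lborel) = a powr (p / 2) * gauss_factor y * local_cost y (f y)"
      by (simp add: local_cost_def cos_Lp_cost_def)
    finally show "(\<integral>\<^sup>+u. ennreal (gauss_factor y * cos_weight \<rho> \<omega> (phase y) u) * ennreal (\<bar>a * y + sqrt a * u - f y\<bar> powr p) \<partial>lborel)
        = ennreal (a powr (p / 2) * gauss_factor y * local_cost y (f y))" .
  qed
  finally show ?thesis .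
qed

lemma local_cost_le:
  "local_cost y (a * y) \<le> 2 * (\<integral>u. \<bar>u\<bar> powr p * std_normal_density u \<partial>lborel)"
proof -
  have i: "integrable lborel (\<lambda>u. \<bar>u\<bar> powr p * std_normal_density u)"
    using p by (intro integrable_abs_powr_normal) simp
  have le: "cos_weight \<rho> \<omega> (phase y) u \<le> 2 * std_normal_density u" for u
  proof -
    have "\<bar>\<rho> * cos (\<omega> * u + phase y)\<bar> \<le> 1 * 1"
      unfolding abs_mult by (rule mult_mono) (use rho in auto)
    then have "1 + \<rho> * cos (\<omega> * u + phase y) \<le> 2" by linarith
    from mult_left_mono[OF this normal_density_nonneg[of 0 1 u]] show ?thesis
      by (simp add: cos_weight_def mult.commute)
  qed
  have "local_cost y (a * y) = (\<integral>u. \<bar>u\<bar> powr p * cos_weight \<rho> \<omega> (phase y) u \<partial>lborel)"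
    by (simp add: local_cost_def cos_Lp_cost_def)
  also have "\<dots> \<le> (\<integral>u. 2 * (\<bar>u\<bar> powr p * std_normal_density u) \<partial>lborel)"
  proof (rule integral_mono)
    show "\<bar>u\<bar> powr p * cos_weight \<rho> \<omega> (phase y) u \<le> 2 * (\<bar>u\<bar> powr p * std_normal_density u)" for u
      using mult_left_mono[OF le[of u], of "\<bar>u\<bar> powr p"] by (simp add: mult_ac)
  qed (use i in \<open>auto intro: integrable_cos_weight\<close>)
  finally show ?thesis by simp
qed

text \<open>The local costs along \<open>a * y\<close> are bounded uniformly in \<open>y\<close>,
  and the Gaussian factor is integrable. A finite optimal cost is what later allows costs to be
  subtracted in \<open>ennreal\<close>.\<close>

lemma cost_linear_finite: "cost (\<lambda>y. a * y) < \<infinity>"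
proof -
  let ?B = "2 * (\<integral>u. \<bar>u\<bar> powr p * std_normal_density u \<partial>lborel)"
  have "integrable lborel (\<lambda>y. exp (- (1 - a) * y\<^sup>2 / 2))"
    using integrable_exp_square_power[of "1 - a" 0] a by simp
  then have i: "integrable lborel (\<lambda>y. a powr (p / 2) * gauss_factor y * ?B)"
    unfolding gauss_factor_def by (intro integrable_mult_left integrable_mult_right)
  have "cost (\<lambda>y. a * y) \<le> (\<integral>\<^sup>+y. ennreal (a powr (p / 2) * gauss_factor y * ?B) \<partial>lborel)"
    unfolding cost_eq[of "\<lambda>y. a * y", simplified]
    using local_cost_le gauss_factor_pos by (intro nn_integral_mono ennreal_leI mult_left_mono) (auto simp: less_imp_le)
  also have "\<dots> < \<infinity>"
  proof (subst nn_integral_eq_integral[OF i])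
    show "AE y in lborel. 0 \<le> a powr (p / 2) * gauss_factor y * ?B"
      using gauss_factor_pos by (intro AE_I2 mult_nonneg_nonneg Bochner_Integration.integral_nonneg) (auto simp: less_imp_le)
  qed simp
  finally show ?thesis .
qed

lemma min_Lp_estimatorI:
  assumes f[measurable]: "f \<in> borel_measurable borel"
    and le: "\<And>y v. local_cost y (f y) \<le> local_cost y v"
  shows "min_Lp_estimator p M X (\<lambda>w. X w + Z w) f"
  unfolding min_Lp_estimator_def
proof (intro conjI f antisym INF_greatest INF_lower)
  fix g :: "real \<Rightarrow> real" assume g: "g \<in> borel_measurable borel"
  show "cost f \<le> cost g"
    unfolding cost_eq[OF f] cost_eq[OF g]
    using le gauss_factor_pos by (intro nn_integral_mono ennreal_leI mult_left_mono) (auto simp: less_imp_le)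
qed

text \<open>Switching to \<open>g\<close> exactly where it is locally cheaper gives a measurable
  competitor \<open>k\<close> that is nowhere worse; optimality of \<open>f\<close> and finiteness
  force equal local costs almost everywhere.\<close>

lemma min_Lp_estimator_imp_AE:
  assumes min: "min_Lp_estimator p M X (\<lambda>w. X w + Z w) f"
    and g[measurable]: "g \<in> borel_measurable borel"
  shows "AE y in lborel. local_cost y (f y) \<le> local_cost y (g y)"
proof -
  have f[measurable]: "f \<in> borel_measurable borel" using min by (simp add: min_Lp_estimator_def)
  have opt: "cost f \<le> cost k" if "k \<in> borel_measurable borel" for k
    using min that by (auto simp: min_Lp_estimator_def intro: INF_lower)
  define k where "k y = (if local_cost y (g y) < local_cost y (f y) then g y else f y)" for y
  have k[measurable]: "k \<in> borel_measurable borel" unfolding k_def[abs_def] by measurable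
  let ?F = "\<lambda>y. ennreal (a powr (p / 2) * gauss_factor y * local_cost y (f y))"
  let ?K = "\<lambda>y. ennreal (a powr (p / 2) * gauss_factor y * local_cost y (k y))"
  have le: "?K y \<le> ?F y" for y
    using gauss_factor_pos[of y] by (intro ennreal_leI mult_left_mono) (auto simp: k_def)
  have "cost k \<le> cost f"
    unfolding cost_eq[OF f] cost_eq[OF k] by (intro nn_integral_mono le)
  with opt[OF k] have eq: "cost f = cost k" by simp
  have "cost f < \<infinity>" using le_less_trans[OF opt cost_linear_finite] by simp
  then have fin: "integral\<^sup>N lborel ?K \<noteq> \<infinity>" using eq cost_eq[OF k] by simp
  have "(\<integral>\<^sup>+y. ?F y - ?K y \<partial>lborel) = integral\<^sup>N lborel ?F - integral\<^sup>N lborel ?K"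
    using le by (intro nn_integral_diff fin) auto
  also have "\<dots> = 0" using eq fin unfolding cost_eq[OF f] cost_eq[OF k] by simp
  finally have "AE y in lborel. ?F y - ?K y = 0" by (subst (asm) nn_integral_0_iff_AE) auto
  then show ?thesis
  proof eventually_elim
    case (elim y)
    then have "?F y \<le> ?K y" by (simp add: diff_eq_0_iff_ennreal)
    then have "a powr (p / 2) * gauss_factor y * local_cost y (f y) \<le> a powr (p / 2) * gauss_factor y * local_cost y (k y)"
      using gauss_factor_pos[of y] local_cost_nonneg by (subst (asm) ennreal_le_iff) auto
    then have "local_cost y (f y) \<le> local_cost y (k y)"
      using gauss_factor_pos[of y] a by simp
    then show ?case by (auto simp: k_def split: if_splits)
  qed
qed

text \<open>The law of \<open>Y\<close> has a Lebesgue density, so Lebesgue-null sets of values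
  \<open>y\<close> have probability 0.\<close>

lemma AE_model:
  assumes [measurable]: "Measurable.pred borel P" and "AE y in lborel. P y"
  shows "AE w in M. P (X w + Z w)"
proof -
  have [measurable]: "X \<in> borel_measurable M" "Z \<in> borel_measurable M"
    using model by (auto simp: gaussian_noise_model_def distributed_def)
  have "(\<integral>\<^sup>+w. (\<lambda>(x, y). indicator {y. \<not> P y} y) (X w, X w + Z w) \<partial>M) = 0"
  proof (subst nn_integral_model)
    show "(\<integral>\<^sup>+y. (\<integral>\<^sup>+u. ennreal (gauss_factor y * cos_weight \<rho> \<omega> (phase y) u) *
        (case (a * y + sqrt a * u, y) of (x, y) \<Rightarrow> indicator {y. \<not> P y} y) \<partial>lborel) \<partial>lborel) = 0"
      using assms(2) by (subst nn_integral_cong_AE[where v="\<lambda>_. 0"]) (auto elim: eventually_mono)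
  qed measurable
  then show ?thesis
    by (subst (asm) nn_integral_0_iff_AE) (auto elim!: eventually_mono split: split_indicator_asm)
qed

lemma local_cost_strict_min:
  assumes "\<rho> * sgn_moment_sin (p - 1) \<omega> = 0" "v \<noteq> a * y"
  shows "local_cost y (a * y) < local_cost y v"
  using cos_Lp_cost_min_0[OF rho nondegenerate_phase, of p] assms p a by (simp add: local_cost_def)

lemma linear_min_Lp_estimator:
  assumes "\<rho> * sgn_moment_sin (p - 1) \<omega> = 0"
  shows "min_Lp_estimator p M X (\<lambda>w. X w + Z w) (\<lambda>y. a * y)"
  using local_cost_strict_min[OF assms] by (intro min_Lp_estimatorI) (simp, metis less_imp_le order_refl)

lemma min_Lp_estimator_unique:
  assumes "\<rho> * sgn_moment_sin (p - 1) \<omega> = 0" and g: "min_Lp_estimator p M X (\<lambda>w. X w + Z w) g"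
  shows "AE w in M. g (X w + Z w) = a * (X w + Z w)"
proof (rule AE_model)
  have [measurable]: "g \<in> borel_measurable borel" using g by (simp add: min_Lp_estimator_def)
  show "Measurable.pred borel (\<lambda>y. g y = a * y)" by measurable
  have "AE y in lborel. local_cost y (g y) \<le> local_cost y (a * y)"
    by (rule min_Lp_estimator_imp_AE[OF g]) measurable
  then show "AE y in lborel. g y = a * y"
    by eventually_elim (use local_cost_strict_min[OF assms(1)] in \<open>meson not_less\<close>)
qed

text \<open>In the coordinate \<open>U\<close>, the conditional minimizer is unique and depends on \<open>y\<close> only through
  \<open>phase y\<close>, hence is periodic in \<open>y\<close>; a linear estimator \<open>c * y\<close> makes it linear in \<open>y\<close>.
  This forces \<open>c = a\<close>, and then first-order optimality at \<open>0\<close> gives the claim.\<close>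
lemma linear_min_Lp_estimator_imp:
  assumes min: "min_Lp_estimator p M X (\<lambda>w. X w + Z w) (\<lambda>y. c * y)" and "\<omega> \<noteq> 0"
  shows "\<rho> * sgn_moment_sin (p - 1) \<omega> = 0"
proof -
  let ?C = "\<lambda>y. cos_Lp_cost p \<rho> \<omega> (phase y)"
  define \<kappa> where "\<kappa> = (c - a) / sqrt a"
  \<comment> \<open>The shift of \<open>y\<close> that advances the phase by one full turn.\<close>
  define T where "T = 2 * pi / (\<omega> * sqrt a)"
  have T: "\<omega> * sqrt a * T = 2 * pi" and "T \<noteq> 0" using \<open>\<omega> \<noteq> 0\<close> a by (auto simp: T_def)
  \<comment> \<open>In the coordinate \<open>U\<close> the estimator \<open>c * y\<close> reads
    \<open>\<kappa> * y\<close>, and every measurable \<open>r\<close> is an admissible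
    competitor.\<close>
  have opt: "AE y in lborel. ?C y (\<kappa> * y) \<le> ?C y (r y)" if [measurable]: "r \<in> borel_measurable borel" for r
  proof -
    have "AE y in lborel. local_cost y (c * y) \<le> local_cost y (a * y + sqrt a * r y)"
      by (rule min_Lp_estimator_imp_AE[OF min]) measurable
    moreover have "(c * y - a * y) / sqrt a = \<kappa> * y" for y by (simp add: \<kappa>_def left_diff_distrib)
    ultimately show ?thesis using a by (simp add: local_cost_def)
  qed
  have periodic: "?C (y + T) = ?C y" for y
  proof -
    have "\<omega> * u + phase (y + T) = (\<omega> * u + phase y) + 2 * pi" for u
      using T by (simp add: phase_def algebra_simps)
    then have "cos (\<omega> * u + phase (y + T)) = cos (\<omega> * u + phase y)" for u
      by (simp only: cos_periodic)
    then have "cos_weight \<rho> \<omega> (phase (y + T)) = cos_weight \<rho> \<omega> (phase y)"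
      by (simp add: cos_weight_def fun_eq_iff)
    then show ?thesis by (simp add: cos_Lp_cost_def fun_eq_iff)
  qed
  have "\<kappa> = 0"
  proof (rule ccontr)
    assume "\<kappa> \<noteq> 0"
    \<comment> \<open>Optimality against \<open>\<kappa> * (y - T)\<close>, read at
      \<open>y + T\<close>. By periodicity \<open>\<kappa> * (y + T)\<close> is then also optimal at
      \<open>y\<close>, so by strict convexity the midpoint \<open>\<kappa> * (y + T / 2)\<close> is
      strictly cheaper than two optimal values.\<close>
    have "AE y in lborel. ?C y (\<kappa> * (y + T)) \<le> ?C y (\<kappa> * y)"
      using AE_lborel_translate[OF opt[of "\<lambda>y. \<kappa> * (y - T)"], of T] by (simp add: periodic)
    moreover have "AE y in lborel. ?C y (\<kappa> * y) \<le> ?C y (\<kappa> * (y + T / 2))"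
      by (rule opt) measurable
    ultimately have "AE y in (lborel :: real measure). False"
    proof eventually_elim
      case (elim y)
      have "2 * ?C y (\<kappa> * (y + T / 2)) < ?C y (\<kappa> * (y + T / 2) - \<kappa> * T / 2) + ?C y (\<kappa> * (y + T / 2) + \<kappa> * T / 2)"
        by (rule cos_Lp_cost_midpoint[OF rho nondegenerate_phase]) (use p \<open>\<kappa> \<noteq> 0\<close> \<open>T \<noteq> 0\<close> in auto)
      moreover have "\<kappa> * (y + T / 2) - \<kappa> * T / 2 = \<kappa> * y" "\<kappa> * (y + T / 2) + \<kappa> * T / 2 = \<kappa> * (y + T)"
        by (simp_all add: algebra_simps)
      ultimately show False using elim by simp
    qed
    then show False using not_AE_lborel_False by blast
  qed
  have all: "AE y in lborel. \<forall>n. ?C y 0 \<le> ?C y (s / real (Suc n))" for s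
    unfolding AE_all_countable using opt[of "\<lambda>_. s / real (Suc n)" for n] \<open>\<kappa> = 0\<close> by simp
  have zero: "AE y in lborel. \<rho> * sin (phase y) * sgn_moment_sin (p - 1) \<omega> = 0"
    using all[of 1] all[of "-1"]
    by eventually_elim (use cos_Lp_cost_min_0_imp[OF rho nondegenerate_phase p] in blast)
  \<comment> \<open>A quarter period turns the sine into the cosine, and the two never vanish
    together; this removes the factor depending on \<open>y\<close>.\<close>
  have quarter: "sin (phase (y + T / 4)) = cos (phase y)" for y
  proof -
    have "phase (y + T / 4) = phase y + pi / 2" using T by (simp add: phase_def algebra_simps)
    then show ?thesis by (simp add: sin_add)
  qed
  show ?thesis
  proof (rule ccontr)
    assume nz: "\<rho> * sgn_moment_sin (p - 1) \<omega> \<noteq> 0"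
    from zero AE_lborel_translate[OF zero, of "T / 4"] have "AE y in (lborel :: real measure). False"
    proof eventually_elim
      case (elim y)
      then have "sin (phase y) = 0" "cos (phase y) = 0" using nz by (auto simp: quarter)
      then show False using sin_cos_squared_add[of "phase y"] by simp
    qed
    then show False using not_AE_lborel_False by blast
  qed
qed

end

section \<open>Sufficiency, necessity and the choice of the frequency\<close>

lemma induces_linear_cos_perturbed_gaussian:
  assumes "0 < a" "a < 1" "\<bar>\<rho>\<bar> \<le> 1" "\<not> (\<omega> = 0 \<and> \<rho> * cos \<theta> = -1)" "2 < p"
    and "\<rho> * sgn_moment_sin (p - 1) \<omega> = 0"
  shows "induces_linear_min_Lp_estimator p (normalized (cos_perturbed_gaussian a \<rho> \<theta> \<omega>))"
  unfolding induces_linear_min_Lp_estimator_def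
\<comment> \<open>The slope \<open>a\<close> is the optimal coefficient for the unperturbed Gaussian
  prior, whose variance is \<open>a / (1 - a)\<close>.\<close>
proof (intro conjI exI[of _ a] allI impI)
  show "prob_density (normalized (cos_perturbed_gaussian a \<rho> \<theta> \<omega>))"
    by (rule prob_density_cos_perturbed_gaussian) fact+
  show "0 \<le> a" using assms by simp
next
  fix M :: "(real \<times> real) measure" and X Z
  assume "gaussian_noise_model (normalized (cos_perturbed_gaussian a \<rho> \<theta> \<omega>)) M X Z"
  then interpret cos_perturbed_model a \<rho> \<theta> \<omega> p M X Z by unfold_locales (use assms in auto)
  show "min_Lp_estimator p M X (\<lambda>w. X w + Z w) ((*) a)"
    using linear_min_Lp_estimator[OF assms(6)] by simp
  show "AE w in M. g (X w + Z w) = a * (X w + Z w)" if "min_Lp_estimator p M X (\<lambda>w. X w + Z w) g" for g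
    using min_Lp_estimator_unique[OF assms(6) that] .
qed

text \<open>The inducing property speaks of all models, so it may be tested on the canonical product
  model alone.\<close>

lemma induces_linear_cos_perturbed_gaussian_imp:
  assumes "0 < a" "a < 1" "\<bar>\<rho>\<bar> \<le> 1" "\<not> (\<omega> = 0 \<and> \<rho> * cos \<theta> = -1)" "2 < p" "\<omega> \<noteq> 0"
    and ind: "induces_linear_min_Lp_estimator p (normalized (cos_perturbed_gaussian a \<rho> \<theta> \<omega>))"
  shows "\<rho> * sgn_moment_sin (p - 1) \<omega> = 0"
proof -
  let ?f = "normalized (cos_perturbed_gaussian a \<rho> \<theta> \<omega>)"
  let ?M = "density lborel (\<lambda>x. ennreal (?f x)) \<Otimes>\<^sub>M density lborel (\<lambda>z. ennreal (std_normal_density z))"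
  from ind have "prob_density ?f" by (simp add: induces_linear_min_Lp_estimator_def)
  then have model: "gaussian_noise_model ?f ?M fst snd" by (rule gaussian_noise_model_canonical)
  then interpret cos_perturbed_model a \<rho> \<theta> \<omega> p ?M fst snd by unfold_locales (use assms in auto)
  obtain c where "min_Lp_estimator p ?M fst (\<lambda>w. fst w + snd w) (\<lambda>y. c * y)"
    using ind model unfolding induces_linear_min_Lp_estimator_def by blast
  then show ?thesis using \<open>\<omega> \<noteq> 0\<close> by (rule linear_min_Lp_estimator_imp)
qed

theorem theorem8:
  fixes p a :: real
  assumes "2 < p" and "0 < a" and "a < 1"
  shows "(\<forall>\<rho> \<theta>. \<bar>\<rho>\<bar> \<le> 1 \<longrightarrow>
            (\<exists>\<omega>. \<omega> \<noteq> 0 \<and>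
               induces_linear_min_Lp_estimator p (normalized (cos_perturbed_gaussian a \<rho> \<theta> \<omega>)))) \<and>
         (\<forall>n::nat. even n \<and> p = real n \<longrightarrow>
            (\<forall>\<rho> \<theta> \<omega>. \<bar>\<rho>\<bar> \<le> 1 \<and> \<not> (\<omega> = 0 \<and> \<rho> * cos \<theta> = -1) \<longrightarrow>
               (hermite_prob (n - 1) \<omega> = 0 \<longrightarrow>
                  induces_linear_min_Lp_estimator p (normalized (cos_perturbed_gaussian a \<rho> \<theta> \<omega>))) \<and>
               (\<rho> \<noteq> 0 \<and>
                  induces_linear_min_Lp_estimator p (normalized (cos_perturbed_gaussian a \<rho> \<theta> \<omega>)) \<longrightarrow>
                  hermite_prob (n - 1) \<omega> = 0)))"
proof (intro conjI allI impI)
  fix \<rho> \<theta> :: real assume "\<bar>\<rho>\<bar> \<le> 1"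
  \<comment> \<open>This frequency depends on \<open>p\<close> only and serves every
    \<open>\<rho>\<close> and \<open>\<theta>\<close>; being positive, it also avoids the degenerate
    density.\<close>
  obtain \<omega> where "0 < \<omega>" "sgn_moment_sin (p - 1) \<omega> = 0"
    using ex_sgn_moment_sin_zero[OF assms(1)] by blast
  then show "\<exists>\<omega>. \<omega> \<noteq> 0 \<and>
      induces_linear_min_Lp_estimator p (normalized (cos_perturbed_gaussian a \<rho> \<theta> \<omega>))"
    using assms \<open>\<bar>\<rho>\<bar> \<le> 1\<close> by (intro exI[of _ \<omega>] conjI induces_linear_cos_perturbed_gaussian) auto
next
  fix n :: nat and \<rho> \<theta> \<omega> :: real
  assume n: "even n \<and> p = real n" and \<rho>: "\<bar>\<rho>\<bar> \<le> 1 \<and> \<not> (\<omega> = 0 \<and> \<rho> * cos \<theta> = -1)"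
  have H: "sgn_moment_sin (p - 1) x = 0 \<longleftrightarrow> hermite_prob (n - 1) x = 0" for x
    using sgn_moment_sin_even_iff_hermite[of n x] n assms(1) by auto
  show "induces_linear_min_Lp_estimator p (normalized (cos_perturbed_gaussian a \<rho> \<theta> \<omega>))"
    if "hermite_prob (n - 1) \<omega> = 0"
    using that H \<rho> assms by (intro induces_linear_cos_perturbed_gaussian) auto
  show "hermite_prob (n - 1) \<omega> = 0"
    if "\<rho> \<noteq> 0 \<and> induces_linear_min_Lp_estimator p (normalized (cos_perturbed_gaussian a \<rho> \<theta> \<omega>))"
  proof (cases "\<omega> = 0")
    case True
    \<comment> \<open>At 0 the sine moment vanishes trivially, so 0 is itself a Hermite zero, in
      keeping with the odd degree \<open>n - 1\<close>.\<close>
    then show ?thesis using H[of 0] by (simp add: sgn_moment_sin_def)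
  next
    case False
    then show ?thesis
      using induces_linear_cos_perturbed_gaussian_imp[of a \<rho> \<omega> \<theta> p] that \<rho> assms H by auto
  qed
qed

end
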